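(* Let $G$ be a real Lie group with Lie algebra $\mathfrak{g}$, let $\mu$ be a Borel probability measure on $G$ with a finite first moment in $\mathfrak{g}$, and let $G_{\mathcal{S}}$ be the closed subgroup of $G$ generated by $\operatorname{supp}(\mu)$. Suppose that the following two conditions hold (with $G_{\mathcal{S}}$ acting on $\mathfrak{g}^{\wedge k}$ via $\mathrm{Ad}^{\wedge k}$): (I') For every $1\le k\le\dim(G)-1$ there exists a proper non-trivial $G_{\mathcal{S}}$-invariant subspace $W_k\subset\mathfrak{g}^{\wedge k}$ such that, for $\mu^{\otimes\mathbb{N}}$-a.e. $b\in G^{\mathbb{N}}$, $W_k$ trivially intersects the Oseledets subspace $V_b^{\leqslant0}\subset\mathfrak{g}^{\wedge k}$ of subexponential expansion. (III') For $1\le k\le\dim(G)-1$, any non-trivial $G_{\mathcal{S}}$-invariant subspace $L$ of $\mathfrak{g}^{\wedge k}$ intersects $W_k$ non-trivially. Then $\mathrm{Ad}_*\mu$ is uniformly expanding on Grassmannians.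
   Context: Fix a norm on $\mathfrak{g}$ and on its exterior powers $\mathfrak{g}^{\wedge k}$. Finite first moment in $\mathfrak{g}$: $\int_G\log N(g)\,d\mu(g)<\infty$, where $N(g)=\max(\|\mathrm{Ad}(g)\|,\|\mathrm{Ad}(g)^{-1}\|)$. Oseledets subspaces: applying Oseledets' multiplicative ergodic theorem to the i.i.d. products $\mathrm{Ad}^{\wedge k}(b_{n-1}\cdots b_0)$ on $\mathfrak{g}^{\wedge k}$, where $b=(b_m)_{m\ge0}$ is distributed according to $\mu^{\otimes\mathbb{N}}$, for a.e. $b$ there is a filtration $\mathfrak{g}^{\wedge k}=V_b^1\supsetneq V_b^2\supsetneq\dots\supsetneq V_b^s\supsetneq V_b^{s+1}=\{0\}$ such that $\lim_n\frac1n\log\|\mathrm{Ad}^{\wedge k}(b_{n-1}\cdots b_0)v\|$ equals the $j$-th largest distinct Lyapunov exponent for $v\in V_b^j\setminus V_b^{j+1}$. The Oseledets subspace of subexponential expansion $V_b^{\leqslant0}$ is the largest $V_b^j$ whose exponent is non-positive (and $\{0\}$ if all exponents are positive). $\mathrm{Ad}_*\mu$ is uniformly expanding on Grassmannians if for every $1\le k\le\dim(G)-1$ and every non-zero pure wedge product $v=v_1\wedge\dots\wedge v_k\in\mathfrak{g}^{\wedge k}$, for $\mu^{\otimes\mathbb{N}}$-a.e. $b$, $\liminf_{n\to\infty}\frac1n\log\|\mathrm{Ad}^{\wedge k}(b_{n-1}\cdots b_0)v\|>0$. *)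

theory Defs
  imports "HOL-Probability.Probability" "HOL-Algebra.Group"
begin

section \<open>Lie groups\<close>

text \<open>Only used for open \<^term>\<open>S\<close>, where \<^term>\<open>at x\<close> is the right filter.\<close>

fun Ck_on :: "nat \<Rightarrow> 'a::euclidean_space set \<Rightarrow> ('a \<Rightarrow> 'b::real_normed_vector) \<Rightarrow> bool" where
  "Ck_on 0 S f \<longleftrightarrow> continuous_on S f"
| "Ck_on (Suc k) S f \<longleftrightarrow>
     (\<forall>x\<in>S. f differentiable at x) \<and>
     (\<forall>v\<in>Basis. Ck_on k S (\<lambda>x. frechet_derivative f (at x) v))"

definition smooth_on :: "'a::euclidean_space set \<Rightarrow> ('a \<Rightarrow> 'b::real_normed_vector) \<Rightarrow> bool" where
  "smooth_on S f \<longleftrightarrow> open S \<and> (\<forall>k. Ck_on k S f)"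

text \<open>A (second countable, Hausdorff) real Lie group of dimension \<^term>\<open>CARD('n)\<close>, given by a
  smooth atlas whose elements are pairs of a chart domain and a chart. Openness of the coordinate
  domains of multiplication and inversion, which is part of \<^const>\<open>smooth_on\<close>, encodes the
  continuity of these maps.\<close>

locale lie_group = group G
  for G :: "'g::{t2_space,second_countable_topology} monoid" (structure)
    and atlas :: "('g set \<times> ('g \<Rightarrow> real^'n)) set" +
  assumes carrier_UNIV: "carrier G = UNIV"
    and chart: "(U, \<phi>) \<in> atlas \<Longrightarrow>
      open U \<and> open (\<phi> ` U) \<and> homeomorphism U (\<phi> ` U) \<phi> (inv_into U \<phi>)"
    and cover: "\<exists>(U, \<phi>)\<in>atlas. g \<in> U"
    and transition: "\<lbrakk>(U, \<phi>) \<in> atlas; (V, \<psi>) \<in> atlas\<rbrakk> \<Longrightarrow>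
      smooth_on (\<phi> ` (U \<inter> V)) (\<lambda>x. \<psi> (inv_into U \<phi> x))"
    and smooth_mult: "\<lbrakk>(U, \<phi>) \<in> atlas; (V, \<psi>) \<in> atlas; (W, \<theta>) \<in> atlas\<rbrakk> \<Longrightarrow>
      smooth_on {(x, y). x \<in> \<phi> ` U \<and> y \<in> \<psi> ` V \<and> inv_into U \<phi> x \<otimes> inv_into V \<psi> y \<in> W}
        (\<lambda>(x, y). \<theta> (inv_into U \<phi> x \<otimes> inv_into V \<psi> y))"
    and smooth_inv: "\<lbrakk>(U, \<phi>) \<in> atlas; (V, \<psi>) \<in> atlas\<rbrakk> \<Longrightarrow>
      smooth_on {x \<in> \<phi> ` U. inv\<^bsub>G\<^esub> (inv_into U \<phi> x) \<in> V}
        (\<lambda>x. \<psi> (inv\<^bsub>G\<^esub> (inv_into U \<phi> x)))"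

text \<open>The Lie algebra is the tangent space at the identity, identified with \<^typ>\<open>real^'n\<close> by a
  chart \<^term>\<open>\<phi>\<close> with domain \<^term>\<open>U\<close> containing the identity; \<^term>\<open>Ad G U \<phi> g\<close> is the
  differential at the identity of conjugation by \<^term>\<open>g\<close>, read in this chart.\<close>

definition Ad ::
  "'g monoid \<Rightarrow> 'g set \<Rightarrow> ('g \<Rightarrow> real^'n) \<Rightarrow> 'g \<Rightarrow> real^'n \<Rightarrow> real^'n" where
  "Ad G U \<phi> g = frechet_derivative
     (\<lambda>x. \<phi> (g \<otimes>\<^bsub>G\<^esub> inv_into U \<phi> x \<otimes>\<^bsub>G\<^esub> inv\<^bsub>G\<^esub> g)) (at (\<phi> \<one>\<^bsub>G\<^esub>))"

definition closed_subgroup_generated :: "'g::topological_space monoid \<Rightarrow> 'g set \<Rightarrow> 'g set" where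
  "closed_subgroup_generated G S = \<Inter>{H. subgroup H G \<and> closed H \<and> S \<subseteq> H}"

definition measure_support :: "'g::topological_space measure \<Rightarrow> 'g set" where
  "measure_support \<mu> = {g. \<forall>O'. open O' \<and> g \<in> O' \<longrightarrow> emeasure \<mu> O' > 0}"

section \<open>Exterior powers\<close>

text \<open>The exterior algebra of \<^typ>\<open>real^'n\<close> is modelled on \<^typ>\<open>real^('n set)\<close>: the unit vector
  at \<open>I = {i\<^sub>1 < \<dots> < i\<^sub>k}\<close> stands for the wedge product of the unit vectors at
  \<open>i\<^sub>1, \<dots>, i\<^sub>k\<close>, in this order. The linear order on the index type only serves to fix these
  signs.\<close>

definition ext_power :: "nat \<Rightarrow> (real^('n::finite set)) set" where
  "ext_power k = {x. \<forall>I. card I \<noteq> k \<longrightarrow> x $ I = 0}"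

text \<open>The coordinate at \<^term>\<open>I\<close> of \<open>v\<^sub>1 \<and> \<dots> \<and> v\<^sub>k\<close> is the minor with rows \<^term>\<open>I\<close> of the
  matrix with columns \<open>v\<^sub>1, \<dots>, v\<^sub>k\<close>, written as a Leibniz sum.\<close>

definition wedge :: "(real^'n::{finite,linorder}) list \<Rightarrow> real^('n set)" where
  "wedge vs = (\<chi> I. if card I = length vs
     then \<Sum>p | p permutes {..<length vs}.
       of_int (sign p) * (\<Prod>j<length vs. (vs ! j) $ (sorted_list_of_set I ! p j))
     else 0)"

text \<open>The linear map sending \<open>e\<^bsub>i\<^sub>1\<^esub> \<and> \<dots> \<and> e\<^bsub>i\<^sub>k\<^esub>\<close> to \<open>A e\<^bsub>i\<^sub>1\<^esub> \<and> \<dots> \<and> A e\<^bsub>i\<^sub>k\<^esub>\<close>, for all \<open>k\<close>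
  simultaneously; its restriction to \<^term>\<open>ext_power k\<close> is the \<^term>\<open>k\<close>-th exterior power of the
  linear map \<^term>\<open>A\<close>.\<close>

definition ext_map ::
  "(real^'n::{finite,linorder} \<Rightarrow> real^'n::{finite,linorder}) \<Rightarrow> real^('n set) \<Rightarrow> real^('n set)" where
  "ext_map A x = (\<Sum>I\<in>UNIV. (x $ I) *\<^sub>R wedge (map (\<lambda>i. A (axis i 1)) (sorted_list_of_set I)))"

section \<open>Norms and the moment condition\<close>

definition norm_on :: "'v::real_vector set \<Rightarrow> ('v \<Rightarrow> real) \<Rightarrow> bool" where
  "norm_on E N \<longleftrightarrow>
     (\<forall>x\<in>E. N x \<ge> 0 \<and> (N x = 0 \<longleftrightarrow> x = 0)) \<and>
     (\<forall>c. \<forall>x\<in>E. N (c *\<^sub>R x) = \<bar>c\<bar> * N x) \<and>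
     (\<forall>x\<in>E. \<forall>y\<in>E. N (x + y) \<le> N x + N y)"

definition op_norm :: "('v::real_vector \<Rightarrow> real) \<Rightarrow> ('v \<Rightarrow> 'v) \<Rightarrow> real" where
  "op_norm N A = (SUP x\<in>{x. N x \<le> 1}. N (A x))"

definition finite_first_moment ::
  "(real^'n \<Rightarrow> real) \<Rightarrow> ('g \<Rightarrow> real^'n \<Rightarrow> real^'n) \<Rightarrow> 'g measure \<Rightarrow> bool" where
  "finite_first_moment N R \<mu> \<longleftrightarrow>
     integrable \<mu> (\<lambda>g. ln (max (op_norm N (R g)) (op_norm N (inv_into UNIV (R g)))))"

section \<open>Random products and Oseledets subspaces\<close>

fun walk :: "('g, 'm) monoid_scheme \<Rightarrow> (nat \<Rightarrow> 'g) \<Rightarrow> nat \<Rightarrow> 'g" where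
  "walk G b 0 = \<one>\<^bsub>G\<^esub>"
| "walk G b (Suc n) = b n \<otimes>\<^bsub>G\<^esub> walk G b n"

text \<open>\<open>E = V 1 \<supset> \<dots> \<supset> V s \<supset> V (s + 1) = {0}\<close> is the Oseledets filtration of \<open>E\<close>
  for the sequence \<open>A\<close> of products, with Lyapunov exponents \<open>\<gamma> 1 > \<dots> > \<gamma> s\<close>.\<close>

definition oseledets_filtration ::
  "'v::real_vector set \<Rightarrow> ('v \<Rightarrow> real) \<Rightarrow> (nat \<Rightarrow> 'v \<Rightarrow> 'v) \<Rightarrow>
   nat \<Rightarrow> (nat \<Rightarrow> real) \<Rightarrow> (nat \<Rightarrow> 'v set) \<Rightarrow> bool" where
  "oseledets_filtration E N A s \<gamma> V \<longleftrightarrow>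
     V 1 = E \<and> V (s + 1) = {0} \<and>
     (\<forall>j\<in>{1..s + 1}. subspace (V j)) \<and>
     (\<forall>j\<in>{1..s}. V (j + 1) \<subset> V j) \<and>
     (\<forall>i\<in>{1..s}. \<forall>j\<in>{1..s}. i < j \<longrightarrow> \<gamma> j < \<gamma> i) \<and>
     (\<forall>j\<in>{1..s}. \<forall>v\<in>V j - V (j + 1). (\<lambda>n. ln (N (A n v)) / real n) \<longlonglongrightarrow> \<gamma> j)"

text \<open>\<open>U\<close> is the Oseledets subspace of subexponential expansion: the largest \<open>V j\<close> (that is, the
  one with the least index) whose exponent is non-positive. A relation rather
  than a function of \<open>A\<close>: by Oseledets' theorem the filtration exists for almost every sequence
  of products only; it is unique when it exists, hence so is \<open>U\<close>.\<close>

definition oseledets_subexp ::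
  "'v::real_vector set \<Rightarrow> ('v \<Rightarrow> real) \<Rightarrow> (nat \<Rightarrow> 'v \<Rightarrow> 'v) \<Rightarrow> 'v set \<Rightarrow> bool" where
  "oseledets_subexp E N A U \<longleftrightarrow>
     (\<exists>s \<gamma> V. oseledets_filtration E N A s \<gamma> V \<and>
        U = (if \<exists>j\<in>{1..s}. \<gamma> j \<le> 0 then V (Min {j\<in>{1..s}. \<gamma> j \<le> 0}) else {0}))"

text \<open>For the representation \<open>R\<close> of \<open>G\<close> on \<open>real^'n\<close> and norms \<open>N k\<close> on the exterior powers.\<close>

definition uniformly_expanding_on_Grassmannians ::
  "'g monoid \<Rightarrow> ('g \<Rightarrow> real^'n::{finite,linorder} \<Rightarrow> real^'n::{finite,linorder}) \<Rightarrow>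
   (nat \<Rightarrow> real^('n set) \<Rightarrow> real) \<Rightarrow> 'g measure \<Rightarrow> bool" where
  "uniformly_expanding_on_Grassmannians G R N \<mu> \<longleftrightarrow>
     (\<forall>k\<in>{1..CARD('n) - 1}. \<forall>vs. length vs = k \<and> wedge vs \<noteq> 0 \<longrightarrow>
        (AE b in Pi\<^sub>M UNIV (\<lambda>_::nat. \<mu>).
           liminf (\<lambda>n. ereal (ln (N k (ext_map (R (walk G b n)) (wedge vs))) / real n)) > 0))"

end

theory Submission
  imports Defs
begin

text \<open>For a nonzero \<open>v\<close> in the \<open>k\<close>-th exterior power let \<open>h v\<close> be the probability that \<open>v\<close> lies in the
  Oseledets subspace of subexponential expansion. As \<open>h\<close> is upper semicontinuous and invariant under
  scaling, it attains its maximum \<open>M\<close>, and as it is \<open>\<mu>\<close>-harmonic, it stays constant along the random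
  walk started at a maximiser. By the Markov property the event that the maximiser lies in the
  Oseledets subspace is then independent of every finite part of the walk, hence of itself, so that
  \<open>M\<close> is \<open>0\<close> or \<open>1\<close>. The vectors \<open>v\<close> with \<open>h v = 1\<close> form, together with \<open>0\<close>, an invariant subspace whose
  intersection with \<open>W k\<close> is trivial by (I'), so it is trivial by (III'). Hence \<open>M = 0\<close>: almost surely
  a given nonzero vector is outside the Oseledets subspace, where the exponents are positive.\<close>

section \<open>Functoriality of exterior powers\<close>

lemma subspace_ext_power: "subspace (ext_power k)"
  by (auto simp: subspace_def ext_power_def)

lemma wedge_in_ext_power: "wedge vs \<in> ext_power (length vs)"
  by (simp add: wedge_def ext_power_def)

lemma linear_ext_map: "linear (ext_map A)"
  unfolding ext_map_def
  by (intro linearI) (simp_all add: algebra_simps sum.distrib scaleR_sum_right)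

lemma ext_map_in_ext_power:
  assumes "x \<in> ext_power k"
  shows "ext_map A x \<in> ext_power k"
  unfolding ext_map_def
proof (intro subspace_sum subspace_ext_power)
  fix I
  show "(x $ I) *\<^sub>R wedge (map (\<lambda>i. A (axis i 1)) (sorted_list_of_set I)) \<in> ext_power k"
  proof (cases "card I = k")
    case True
    then show ?thesis
      using wedge_in_ext_power[of "map (\<lambda>i. A (axis i 1)) (sorted_list_of_set I)"]
      by (simp add: subspace_scale subspace_ext_power)
  next
    case False
    then have "x $ I = 0"
      using assms by (simp add: ext_power_def)
    then show ?thesis
      by (simp add: subspace_0 subspace_ext_power)
  qed
qed

text \<open>A Leibniz term is nonzero only if \<open>p\<close> matches the increasing enumeration of
  \<open>I\<close> with that of \<open>J\<close> entry by entry. This forces \<open>J = I\<close>,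
  and then \<open>p = id\<close> because the enumeration has no repetitions.\<close>

lemma wedge_axis:
  fixes I :: "'n::{finite,linorder} set"
  shows "wedge (map (\<lambda>i. axis i 1) (sorted_list_of_set I)) = axis I 1"
proof (rule vec_eq_iff[THEN iffD2], rule allI)
  fix J :: "'n set"
  let ?k = "card I"
  let ?i = "\<lambda>j. sorted_list_of_set I ! j" and ?j = "\<lambda>j. sorted_list_of_set J ! j"
  show "wedge (map (\<lambda>i. axis i 1) (sorted_list_of_set I)) $ J = (axis I 1 :: real^('n set)) $ J"
  proof (cases "card J = ?k")
    case False
    then show ?thesis
      by (auto simp: wedge_def axis_def)
  next
    case card: True
    have zero: "(\<Prod>j<?k. (axis (?i j) (1::real)) $ ?j (p j)) = 0"
      if p: "p permutes {..<?k}" and ne: "\<not> (J = I \<and> p = id)" for p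
    proof -
      have "\<exists>j<?k. ?j (p j) \<noteq> ?i j"
      proof (rule ccontr)
        assume "\<not> (\<exists>j<?k. ?j (p j) \<noteq> ?i j)"
        then have eq: "?j (p j) = ?i j" if "j < ?k" for j
          using that by blast
        have lt: "p j < ?k" if "j < ?k" for j
          using permutes_in_image[OF p, of j] that by simp
        have "I \<subseteq> J"
        proof
          fix x assume "x \<in> I"
          then obtain j where "j < ?k" "x = ?i j"
            by (metis finite in_set_conv_nth length_sorted_list_of_set set_sorted_list_of_set)
          then show "x \<in> J"
            using eq[of j] lt[of j] card
            by (metis finite length_sorted_list_of_set nth_mem set_sorted_list_of_set)
        qed
        then have "I = J"
          using card by (simp add: card_subset_eq)
        moreover have "p j = j" for j
        proof (cases "j < ?k")
          case True
          then show ?thesis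
            using eq[OF True] lt[OF True] \<open>I = J\<close>
            by (simp add: nth_eq_iff_index_eq)
        next
          case False
          then show ?thesis
            using p by (simp add: permutes_def)
        qed
        ultimately show False
          using ne by (auto simp: fun_eq_iff)
      qed
      then show ?thesis
        by (auto simp: axis_def)
    qed
    show ?thesis
    proof (cases "J = I")
      case True
      have "(\<Sum>p | p permutes {..<?k}. of_int (sign p) * (\<Prod>j<?k. (axis (?i j) (1::real)) $ ?j (p j)))
          = (\<Sum>p\<in>{id}. of_int (sign p) * (\<Prod>j<?k. (axis (?i j) (1::real)) $ ?j (p j)))"
        using zero by (intro sum.mono_neutral_right) (auto simp: permutes_id finite_permutations)
      then show ?thesis
        using True by (simp add: wedge_def axis_def)
    next
      case False
      then have "(\<Sum>p | p permutes {..<?k}. of_int (sign p) * (\<Prod>j<?k. (axis (?i j) (1::real)) $ ?j (p j))) = 0"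
        using zero by (intro sum.neutral) auto
      then show ?thesis
        using False card by (simp add: wedge_def axis_def)
    qed
  qed
qed

lemma ext_map_id: "ext_map (\<lambda>v. v) = (\<lambda>x. x)"
  unfolding ext_map_def wedge_axis
  by (simp add: fun_eq_iff vec_eq_iff axis_def if_distrib[of "\<lambda>t. _ * t"] cong: if_cong)

section \<open>Leibniz sums and the Cauchy--Binet formula\<close>

lemma leibniz_sum_compose:
  fixes a :: "nat \<Rightarrow> 'i \<Rightarrow> real"
  assumes q: "q permutes {..<k}"
  shows "(\<Sum>p | p permutes {..<k}. of_int (sign p) * (\<Prod>j<k. a (p j) (f (q j)))) =
    of_int (sign q) * (\<Sum>p | p permutes {..<k}. of_int (sign p) * (\<Prod>j<k. a (p j) (f j)))"
proof -
  \<comment> \<open>Replacing \<open>p\<close> by \<open>p \<circ> q\<close> makes both arguments of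
    \<open>a\<close> depend on \<open>q j\<close>, so \<open>q\<close> can be removed by permuting
    the factors; only its sign remains.\<close>
  have "(\<Sum>p | p permutes {..<k}. of_int (sign p) * (\<Prod>j<k. a (p j) (f (q j)))) =
    (\<Sum>p | p permutes {..<k}. of_int (sign (p \<circ> q)) * (\<Prod>j<k. a ((p \<circ> q) j) (f (q j))))"
    by (rule sum_permutations_compose_right[OF q])
  also have "\<dots> = (\<Sum>p | p permutes {..<k}. of_int (sign q) * (of_int (sign p) * (\<Prod>j<k. a (p j) (f j))))"
  proof (rule sum.cong[OF refl])
    fix p assume "p \<in> {p. p permutes {..<k}}"
    then have p: "p permutes {..<k}" by simp
    have "(\<Prod>j<k. a (p (q j)) (f (q j))) = (\<Prod>j<k. a (p j) (f j))"
      using prod.permute[OF q, of "\<lambda>j. a (p j) (f j)"] by (simp add: o_def)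
    moreover have "sign (p \<circ> q) = sign p * sign q"
      using p q by (simp add: sign_compose permutation_permutes[THEN iffD2] permutation_permutes exI[of _ "{..<k}"])
    ultimately show "of_int (sign (p \<circ> q)) * (\<Prod>j<k. a ((p \<circ> q) j) (f (q j)))
      = of_int (sign q) * (of_int (sign p) * (\<Prod>j<k. a (p j) (f j)))"
      by simp
  qed
  finally show ?thesis
    by (simp add: sum_distrib_left)
qed

text \<open>A determinant with two equal columns vanishes: swapping these columns leaves the sum
  unchanged but also reverses its sign.\<close>

lemma leibniz_sum_not_inj:
  fixes a :: "nat \<Rightarrow> 'i \<Rightarrow> real"
  assumes "\<not> inj_on f {..<k}"
  shows "(\<Sum>p | p permutes {..<k}. of_int (sign p) * (\<Prod>j<k. a (p j) (f j))) = 0"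
proof -
  obtain s t where st: "s < k" "t < k" "s \<noteq> t" "f s = f t"
    using assms by (auto simp: inj_on_def)
  let ?q = "Transposition.transpose s t"
  have q: "?q permutes {..<k}"
    using st by (intro permutes_swap_id) auto
  have "f (?q j) = f j" for j
    using st by (simp add: Transposition.transpose_def)
  with leibniz_sum_compose[OF q, of a f] show ?thesis
    using st by (simp add: sign_swap_id)
qed

text \<open>This bijection turns the Leibniz expansion of a minor of a product into the Cauchy--Binet sum
  over \<open>k\<close>-subsets.\<close>

lemma bij_betw_injections:
  fixes k :: nat
  shows "bij_betw (\<lambda>(I, q). restrict (\<lambda>j. sorted_list_of_set I ! q j) {..<k})
    (SIGMA I:{I::'n::{finite,linorder} set. card I = k}. {q. q permutes {..<k}})
    {f \<in> {..<k} \<rightarrow>\<^sub>E UNIV. inj_on f {..<k}}"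
proof -
  let ?F = "\<lambda>(I::'n set, q). restrict (\<lambda>j. sorted_list_of_set I ! q j) {..<k}"
  let ?D = "SIGMA I:{I::'n set. card I = k}. {q. q permutes {..<k}}"
  have bij: "bij_betw ((!) (sorted_list_of_set I)) {..<k} I" if "card I = k" for I :: "'n set"
    using that bij_betw_nth[of "sorted_list_of_set I" "{..<k}" I] by simp
  have comp: "bij_betw (\<lambda>j. sorted_list_of_set I ! q j) {..<k} I" if "card I = k" "q permutes {..<k}"
    for I :: "'n set" and q
    using bij_betw_trans[OF permutes_imp_bij[OF that(2)] bij[OF that(1)]] by (simp add: o_def)
  have image: "?F (I, q) ` {..<k} = I" if "card I = k" "q permutes {..<k}" for I q
    using bij_betw_imp_surj_on[OF comp[OF that]] by auto
  show ?thesis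
    unfolding bij_betw_def
  proof
    show "inj_on ?F ?D"
    proof (rule inj_onI)
      fix x y
      assume x: "x \<in> ?D" and y: "y \<in> ?D" and xy: "?F x = ?F y"
      obtain I q I' q' where [simp]: "x = (I, q)" "y = (I', q')"
        by (cases x, cases y)
      have I: "card I = k" "q permutes {..<k}" "card I' = k" "q' permutes {..<k}"
        using x y by auto
      have "?F (I', q') ` {..<k} = ?F (I, q) ` {..<k}"
        using xy by simp
      then have "I' = I"
        unfolding image[OF I(1,2)] image[OF I(3,4)] .
      moreover have "q j = q' j" for j
      proof (cases "j < k")
        case True
        then have "sorted_list_of_set I ! q j = sorted_list_of_set I ! q' j"
          using fun_cong[OF xy, of j] \<open>I' = I\<close> by simp
        moreover have "q j < k" "q' j < k"
          using True permutes_in_image[OF I(2), of j] permutes_in_image[OF I(4), of j] by auto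
        ultimately show ?thesis
          using I(1) by (simp add: nth_eq_iff_index_eq)
      next
        case False
        then show ?thesis
          using I by (simp add: permutes_def)
      qed
      ultimately show "x = y"
        by auto
    qed
    show "?F ` ?D = {f \<in> {..<k} \<rightarrow>\<^sub>E UNIV. inj_on f {..<k}}"
    proof (intro equalityI subsetI)
      fix f assume "f \<in> ?F ` ?D"
      then obtain I q where "card I = k" "q permutes {..<k}" "f = ?F (I, q)"
        by auto
      then show "f \<in> {f \<in> {..<k} \<rightarrow>\<^sub>E UNIV. inj_on f {..<k}}"
        using bij_betw_imp_inj_on[OF comp[of I q]] by (auto simp: inj_on_def)
    next
      fix f assume f: "f \<in> {f \<in> {..<k} \<rightarrow>\<^sub>E (UNIV :: 'n set). inj_on f {..<k}}"
      define I where "I = f ` {..<k}"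
      have I: "card I = k"
        using f by (simp add: I_def card_image)
      \<comment> \<open>The permutation belonging to \<open>f\<close> sends \<open>j\<close> to the
        position of \<open>f j\<close> in the increasing enumeration of the image of
        \<open>f\<close>.\<close>
      define g where "g = inv_into {..<k} ((!) (sorted_list_of_set I)) \<circ> f"
      have "bij_betw g {..<k} {..<k}"
        unfolding g_def using f bij_betw_inv_into[OF bij[OF I]]
        by (intro bij_betw_trans[of _ _ I]) (auto simp: I_def bij_betw_def)
      \<comment> \<open>Being a permutation in the sense of \<open>permutes\<close> requires fixing
        every index outside \<open>{..<k}\<close>.\<close>
      then have "bij_betw (\<lambda>j. if j < k then g j else j) {..<k} {..<k}"
        by (rule bij_betw_cong[THEN iffD1, rotated]) simp
      then have perm: "(\<lambda>j. if j < k then g j else j) permutes {..<k}"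
        by (intro bij_imp_permutes) simp_all
      have "f = ?F (I, \<lambda>j. if j < k then g j else j)"
      proof
        fix j
        show "f j = ?F (I, \<lambda>j. if j < k then g j else j) j"
        proof (cases "j < k")
          case True
          then have "f j \<in> I" by (simp add: I_def)
          then show ?thesis
            using True bij_betw_inv_into_right[OF bij[OF I]] by (simp add: g_def)
        next
          case False
          then show ?thesis
            using f by (auto simp: PiE_def extensional_def)
        qed
      qed
      then show "f \<in> ?F ` ?D"
        using I perm by blast
    qed
  qed
qed

text \<open>This is the Cauchy--Binet formula. A minor of the images is expanded multilinearly over
  all choices \<open>f\<close> of one unit vector per factor; the non-injective choices cancel, and
  each injective one splits into its image \<open>I\<close> and a permutation. Summing over the
  permutations produces the coordinate of \<open>wedge vs\<close> at \<open>I\<close>.\<close>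

lemma ext_map_wedge:
  fixes A :: "real^'n::{finite,linorder} \<Rightarrow> real^'n::{finite,linorder}"
  assumes "linear A"
  shows "ext_map A (wedge vs) = wedge (map A vs)"
proof (rule vec_eq_iff[THEN iffD2], rule allI)
  fix J :: "'n set"
  define k where "k = length vs"
  show "ext_map A (wedge vs) $ J = wedge (map A vs) $ J"
  proof (cases "card J = k")
    case False
    then show ?thesis
      using ext_map_in_ext_power[OF wedge_in_ext_power, of A vs]
      by (simp add: k_def ext_power_def wedge_def)
  next
    case J: True
    define a where "a r i = A (axis i 1) $ (sorted_list_of_set J ! r)" for r i
    \<comment> \<open>\<open>D f\<close> is the determinant whose \<open>j\<close>-th column is the
      column \<open>f j\<close> of the matrix of \<open>A\<close>, restricted to the rows in
      \<open>J\<close>.\<close>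
    define D where "D f = (\<Sum>p | p permutes {..<k}. of_int (sign p) * (\<Prod>j<k. a (p j) (f j)))" for f
    have A: "A v $ (sorted_list_of_set J ! r) = (\<Sum>i\<in>UNIV. v $ i * a r i)" for v r
    proof -
      have "v = (\<Sum>i\<in>UNIV. v $ i *\<^sub>R axis i 1)"
        by (simp add: vec_eq_iff axis_def if_distrib[of "\<lambda>t. _ * t"] cong: if_cong)
      then have "A v = A (\<Sum>i\<in>UNIV. v $ i *\<^sub>R axis i 1)"
        by simp
      also have "\<dots> = (\<Sum>i\<in>UNIV. v $ i *\<^sub>R A (axis i 1))"
        by (simp add: linear_sum[OF assms] linear_cmul[OF assms])
      finally show ?thesis
        by (simp add: a_def)
    qed
    have D_cong: "D f = D g" if "\<And>j. j < k \<Longrightarrow> f j = g j" for f g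
      using that by (simp add: D_def)
    have "wedge (map A vs) $ J = (\<Sum>p | p permutes {..<k}. of_int (sign p) *
        (\<Prod>j<k. \<Sum>i\<in>UNIV. vs ! j $ i * a (p j) i))"
      using J by (simp add: wedge_def k_def A)
    also have "\<dots> = (\<Sum>p | p permutes {..<k}. \<Sum>f\<in>{..<k} \<rightarrow>\<^sub>E UNIV. of_int (sign p) *
        (\<Prod>j<k. vs ! j $ f j * a (p j) (f j)))"
      by (simp add: prod_sum_PiE sum_distrib_left)
    also have "\<dots> = (\<Sum>f\<in>{..<k} \<rightarrow>\<^sub>E UNIV. \<Sum>p | p permutes {..<k}. of_int (sign p) *
        (\<Prod>j<k. vs ! j $ f j * a (p j) (f j)))"
      by (rule sum.swap)
    also have "\<dots> = (\<Sum>f\<in>{..<k} \<rightarrow>\<^sub>E UNIV. (\<Prod>j<k. vs ! j $ f j) * D f)"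
      by (simp add: D_def sum_distrib_left prod.distrib mult_ac)
    also have "\<dots> = (\<Sum>f\<in>{f \<in> {..<k} \<rightarrow>\<^sub>E UNIV. inj_on f {..<k}}. (\<Prod>j<k. vs ! j $ f j) * D f)"
      unfolding D_def
      by (intro sum.mono_neutral_right) (auto simp: finite_PiE leibniz_sum_not_inj)
    also have "\<dots> = (\<Sum>(I, q)\<in>(SIGMA I:{I. card I = k}. {q. q permutes {..<k}}).
        (\<Prod>j<k. vs ! j $ (sorted_list_of_set I ! q j)) * D (\<lambda>j. sorted_list_of_set I ! q j))"
      by (subst sum.reindex_bij_betw[OF bij_betw_injections, symmetric])
         (auto intro!: sum.cong arg_cong2[of _ _ _ _ "(*)"] D_cong)
    also have "\<dots> = (\<Sum>(I, q)\<in>(SIGMA I:{I. card I = k}. {q. q permutes {..<k}}).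
        (of_int (sign q) * (\<Prod>j<k. vs ! j $ (sorted_list_of_set I ! q j))) * D ((!) (sorted_list_of_set I)))"
      by (intro sum.cong) (auto simp: D_def leibniz_sum_compose)
    also have "\<dots> = (\<Sum>I | card I = k. wedge vs $ I * D ((!) (sorted_list_of_set I)))"
      by (subst sum.Sigma[symmetric])
         (auto simp: finite_permutations wedge_def k_def sum_distrib_right intro!: sum.cong)
    also have "\<dots> = (\<Sum>I | card I = k. wedge vs $ I * wedge (map (\<lambda>i. A (axis i 1)) (sorted_list_of_set I)) $ J)"
      using J by (intro sum.cong) (auto simp: wedge_def D_def a_def)
    also have "\<dots> = (\<Sum>I\<in>UNIV. wedge vs $ I * wedge (map (\<lambda>i. A (axis i 1)) (sorted_list_of_set I)) $ J)"
      by (intro sum.mono_neutral_left) (auto simp: wedge_def k_def)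
    finally show ?thesis
      by (simp add: ext_map_def)
  qed
qed

text \<open>By linearity it suffices to treat unit vectors, where \<open>ext_map_wedge\<close>
  applies to the wedge of their images under \<open>B\<close>. Hence exterior powers of a
  representation are again representations.\<close>

lemma ext_map_compose:
  assumes "linear A"
  shows "ext_map (\<lambda>v. A (B v)) x = ext_map A (ext_map B x)"
  by (simp add: ext_map_def[of B] ext_map_def[of "\<lambda>v. A (B v)"] ext_map_wedge[OF assms] o_def
      linear_sum[OF linear_ext_map] linear_cmul[OF linear_ext_map])

text \<open>The coefficients of \<open>ext_map (R g)\<close> are minors, hence polynomials in the
  matrix entries of \<open>R g\<close>.\<close>

lemma continuous_on_ext_map:
  fixes R :: "'a::topological_space \<Rightarrow> real^'n::{finite,linorder} \<Rightarrow> real^'n::{finite,linorder}"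
  assumes "\<And>v. continuous_on S (\<lambda>g. R g v)"
  shows "continuous_on S (\<lambda>g. ext_map (R g) x)"
proof -
  have "continuous_on S (\<lambda>g. wedge (map (\<lambda>i. R g (axis i 1)) (sorted_list_of_set I)) $ J)" for I J
    by (cases "card J = card I") (auto simp: wedge_def intro!: continuous_intros assms)
  then have "continuous_on S (\<lambda>g. \<chi> J. wedge (map (\<lambda>i. R g (axis i 1)) (sorted_list_of_set I)) $ J)" for I
    by (intro continuous_on_vec_lambda)
  then have "continuous_on S (\<lambda>g. wedge (map (\<lambda>i. R g (axis i 1)) (sorted_list_of_set I)))" for I
    by simp
  then show ?thesis
    unfolding ext_map_def by (intro continuous_intros)
qed

section \<open>The adjoint representation\<close>

lemma smooth_on_differentiable: "smooth_on S f \<Longrightarrow> x \<in> S \<Longrightarrow> f differentiable at x"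
  unfolding smooth_on_def by (metis Ck_on.simps(2))

lemma smooth_on_continuous_on: "smooth_on S f \<Longrightarrow> continuous_on S f"
  unfolding smooth_on_def by (metis Ck_on.simps(1))

lemma smooth_on_has_derivative:
  "smooth_on S f \<Longrightarrow> x \<in> S \<Longrightarrow> (f has_derivative frechet_derivative f (at x)) (at x)"
  using smooth_on_differentiable frechet_derivative_works by blast

text \<open>Smoothness gives continuity of the derivative in the base point along each fixed basis
  direction. Expanding \<open>c t\<close> in the basis lets the direction vary as well.\<close>

lemma continuous_on_frechet_derivative:
  assumes f: "smooth_on S f"
    and a: "continuous_on T a" "a ` T \<subseteq> S" and c: "continuous_on T c"
  shows "continuous_on T (\<lambda>t. frechet_derivative f (at (a t)) (c t))"
proof -
  have "continuous_on S (\<lambda>x. frechet_derivative f (at x) b)" if "b \<in> Basis" for b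
    using f that unfolding smooth_on_def by (metis Ck_on.simps(1,2) One_nat_def)
  then have b: "continuous_on T (\<lambda>t. frechet_derivative f (at (a t)) b)" if "b \<in> Basis" for b
    using continuous_on_compose2[OF _ a] that by blast
  have "frechet_derivative f (at (a t)) (c t) =
      (\<Sum>b\<in>Basis. (c t \<bullet> b) *\<^sub>R frechet_derivative f (at (a t)) b)" if "t \<in> T" for t
  proof -
    have lin: "linear (frechet_derivative f (at (a t)))"
      using smooth_on_has_derivative[OF f] that a(2) has_derivative_linear by blast
    have "frechet_derivative f (at (a t)) (\<Sum>b\<in>Basis. (c t \<bullet> b) *\<^sub>R b) =
        (\<Sum>b\<in>Basis. (c t \<bullet> b) *\<^sub>R frechet_derivative f (at (a t)) b)"
      by (simp only: linear_sum[OF lin] linear_cmul[OF lin])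
    then show ?thesis
      by (simp add: euclidean_representation)
  qed
  moreover have "continuous_on T (\<lambda>t. \<Sum>b\<in>Basis. (c t \<bullet> b) *\<^sub>R frechet_derivative f (at (a t)) b)"
    by (intro continuous_intros b c)
  ultimately show ?thesis
    by (simp cong: continuous_on_cong)
qed

lemma has_derivative_transform_nhds:
  assumes "(f has_derivative f') (at x)" "\<forall>\<^sub>F y in nhds x. f y = g y"
  shows "(g has_derivative f') (at x)"
proof (rule has_derivative_transform_eventually[OF assms(1)])
  show "\<forall>\<^sub>F y in at x. f y = g y"
    using assms(2) by (simp add: eventually_nhds_conv_at)
  show "f x = g x"
    using assms(2) by (rule eventually_nhds_x_imp_x)
qed simp

section \<open>Conjugation in charts and its derivative\<close>

context lie_group
begin

lemma in_carrier [simp]: "g \<in> carrier G"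
  by (simp add: carrier_UNIV)

lemma chart_left_inv: "(U, \<phi>) \<in> atlas \<Longrightarrow> g \<in> U \<Longrightarrow> inv_into U \<phi> (\<phi> g) = g"
  using chart unfolding homeomorphism_def by blast

lemma chart_continuous: "(U, \<phi>) \<in> atlas \<Longrightarrow> continuous_on U \<phi>"
  using chart unfolding homeomorphism_def by blast

text \<open>Conjugation by \<open>g\<close> near the identity is \<open>x \<mapsto> g x\<close>, from \<open>1\<close> to \<open>g\<close>, followed by
  \<open>z \<mapsto> z g\<inverse>\<close>, from \<open>g\<close> back to \<open>1\<close>; in charts around \<open>1\<close>, \<open>g\<close> and \<open>g\<inverse>\<close> both are sections of
  the multiplication.\<close>

lemma conjugation_in_charts:
  assumes U: "(U, \<phi>) \<in> atlas" "\<one> \<in> U"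
    and V: "(V, \<psi>) \<in> atlas" "g \<in> V" and V': "(V', \<psi>') \<in> atlas" "inv g \<in> V'"
  defines "m1 \<equiv> \<lambda>(x, y). \<psi> (inv_into V \<psi> x \<otimes> inv_into U \<phi> y)"
    and "m2 \<equiv> \<lambda>(x, y). \<phi> (inv_into V \<psi> x \<otimes> inv_into V' \<psi>' y)"
  shows conjugation_eventually_in_chart:
      "\<forall>\<^sub>F x in nhds (\<phi> \<one>). g \<otimes> inv_into U \<phi> x \<otimes> inv g \<in> U"
    and Ad_has_derivative:
      "((\<lambda>x. \<phi> (g \<otimes> inv_into U \<phi> x \<otimes> inv g)) has_derivative Ad G U \<phi> g) (at (\<phi> \<one>))"
    and Ad_in_charts: "Ad G U \<phi> g v = frechet_derivative m2 (at (\<psi> g, \<psi>' (inv g)))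
      (frechet_derivative m1 (at (\<psi> g, \<phi> \<one>)) (0, v), 0)"
proof -
  let ?S1 = "{(x, y). x \<in> \<psi> ` V \<and> y \<in> \<phi> ` U \<and> inv_into V \<psi> x \<otimes> inv_into U \<phi> y \<in> V}"
  let ?S2 = "{(x, y). x \<in> \<psi> ` V \<and> y \<in> \<psi>' ` V' \<and> inv_into V \<psi> x \<otimes> inv_into V' \<psi>' y \<in> U}"
  let ?F = "\<lambda>x. \<phi> (g \<otimes> inv_into U \<phi> x \<otimes> inv g)"
  let ?l = "\<lambda>x. m1 (\<psi> g, x)"
  have m1: "smooth_on ?S1 m1" and m2: "smooth_on ?S2 m2"
    unfolding m1_def m2_def by (rule smooth_mult[OF V(1) U(1) V(1)] smooth_mult[OF V(1) V'(1) U(1)])+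
  have open12: "open ?S1" "open ?S2"
    using m1 m2 by (auto simp: smooth_on_def)
  have inv_g: "inv_into V \<psi> (\<psi> g) = g" "inv_into V' \<psi>' (\<psi>' (inv g)) = inv g"
    "inv_into U \<phi> (\<phi> \<one>) = \<one>"
    using chart_left_inv U V V' by auto
  have in1: "(\<psi> g, \<phi> \<one>) \<in> ?S1" and in2: "(\<psi> g, \<psi>' (inv g)) \<in> ?S2"
    using U V V' by (auto simp: inv_g)
  have m1_g: "?l (\<phi> \<one>) = \<psi> g"
    by (simp add: m1_def inv_g)
  have der1: "(m1 has_derivative frechet_derivative m1 (at (\<psi> g, \<phi> \<one>))) (at (\<psi> g, \<phi> \<one>))"
    by (rule smooth_on_has_derivative[OF m1 in1])
  have der2: "(m2 has_derivative frechet_derivative m2 (at (\<psi> g, \<psi>' (inv g)))) (at (\<psi> g, \<psi>' (inv g)))"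
    by (rule smooth_on_has_derivative[OF m2 in2])
  have der_l: "(?l has_derivative (\<lambda>v. frechet_derivative m1 (at (\<psi> g, \<phi> \<one>)) (0, v))) (at (\<phi> \<one>))"
    using has_derivative_compose[of "\<lambda>x. (\<psi> g, x)" "\<lambda>v. (0, v)" "\<phi> \<one>" UNIV m1, OF _ der1]
    by (simp add: has_derivative_Pair[OF has_derivative_const has_derivative_ident])
  have "((\<lambda>x. (?l x, \<psi>' (inv g))) has_derivative
      (\<lambda>v. (frechet_derivative m1 (at (\<psi> g, \<phi> \<one>)) (0, v), 0))) (at (\<phi> \<one>))"
    by (intro has_derivative_Pair der_l has_derivative_const)
  from has_derivative_compose[OF this, of m2] der2
  have der: "((\<lambda>x. m2 (?l x, \<psi>' (inv g))) has_derivative (\<lambda>v. frechet_derivative m2 (at (\<psi> g, \<psi>' (inv g)))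
      (frechet_derivative m1 (at (\<psi> g, \<phi> \<one>)) (0, v), 0))) (at (\<phi> \<one>))"
    unfolding m1_g by blast
  have ev1: "\<forall>\<^sub>F x in nhds (\<phi> \<one>). (\<psi> g, x) \<in> ?S1"
    using in1 open12(1)
    by (intro topological_tendstoD[of "\<lambda>x. (\<psi> g, x)" "(\<psi> g, \<phi> \<one>)"]) (auto intro!: tendsto_intros filterlim_ident)
  have "isCont ?l (\<phi> \<one>)"
    using der_l has_derivative_continuous by blast
  then have "(?l \<longlongrightarrow> \<psi> g) (nhds (\<phi> \<one>))"
    using m1_g by (metis isCont_def tendsto_at_iff_tendsto_nhds)
  then have ev2: "\<forall>\<^sub>F x in nhds (\<phi> \<one>). (?l x, \<psi>' (inv g)) \<in> ?S2"
    using in2 open12(2)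
    by (intro topological_tendstoD[of "\<lambda>x. (?l x, \<psi>' (inv g))" "(\<psi> g, \<psi>' (inv g))"]) (auto intro!: tendsto_intros)
  \<comment> \<open>While both arguments stay in the coordinate domains, the chart around
    \<open>g\<close> cancels between the two multiplications and their composite is
    conjugation.\<close>
  have ev: "\<forall>\<^sub>F x in nhds (\<phi> \<one>). g \<otimes> inv_into U \<phi> x \<otimes> inv g \<in> U \<and> m2 (?l x, \<psi>' (inv g)) = ?F x"
    using ev1 ev2
  proof eventually_elim
    case (elim x)
    then have "inv_into V \<psi> (?l x) = g \<otimes> inv_into U \<phi> x"
      using chart_left_inv[OF V(1)] by (auto simp: m1_def inv_g)
    then show ?case
      using elim by (auto simp: m2_def inv_g)
  qed
  then show "\<forall>\<^sub>F x in nhds (\<phi> \<one>). g \<otimes> inv_into U \<phi> x \<otimes> inv g \<in> U"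
    by (rule eventually_mono) simp
  have "(?F has_derivative (\<lambda>v. frechet_derivative m2 (at (\<psi> g, \<psi>' (inv g)))
      (frechet_derivative m1 (at (\<psi> g, \<phi> \<one>)) (0, v), 0))) (at (\<phi> \<one>))"
    by (rule has_derivative_transform_nhds[OF der eventually_mono[OF ev]]) simp
  \<comment> \<open>\<open>Ad\<close> is a chosen derivative, so it has the expected property only
    once some derivative is known to exist.\<close>
  moreover from this have Ad: "(?F has_derivative Ad G U \<phi> g) (at (\<phi> \<one>))"
    unfolding Ad_def using frechet_derivative_works differentiable_def by blast
  ultimately have "Ad G U \<phi> g = (\<lambda>v. frechet_derivative m2 (at (\<psi> g, \<psi>' (inv g)))
      (frechet_derivative m1 (at (\<psi> g, \<phi> \<one>)) (0, v), 0))"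
    using has_derivative_unique by blast
  then show "Ad G U \<phi> g v = frechet_derivative m2 (at (\<psi> g, \<psi>' (inv g)))
      (frechet_derivative m1 (at (\<psi> g, \<phi> \<one>)) (0, v), 0)"
    by simp
  show "(?F has_derivative Ad G U \<phi> g) (at (\<phi> \<one>))"
    by (rule Ad)
qed

lemma chart_around:
  obtains V \<psi> where "(V, \<psi>) \<in> atlas" "g \<in> V"
  using cover[of g] by blast

context
  fixes U :: "'g set" and \<phi> :: "'g \<Rightarrow> real^'n"
  assumes U: "(U, \<phi>) \<in> atlas" "\<one> \<in> U"
begin

lemma
  shows conjugation_eventually: "\<forall>\<^sub>F x in nhds (\<phi> \<one>). g \<otimes> inv_into U \<phi> x \<otimes> inv g \<in> U"
    and has_derivative_Ad: "((\<lambda>x. \<phi> (g \<otimes> inv_into U \<phi> x \<otimes> inv g)) has_derivative Ad G U \<phi> g) (at (\<phi> \<one>))"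
proof -
  obtain V \<psi> V' \<psi>' where "(V, \<psi>) \<in> atlas" "g \<in> V" "(V', \<psi>') \<in> atlas" "inv g \<in> V'"
    using chart_around by metis
  note charts = U this
  show "\<forall>\<^sub>F x in nhds (\<phi> \<one>). g \<otimes> inv_into U \<phi> x \<otimes> inv g \<in> U"
    by (rule conjugation_eventually_in_chart[OF charts])
  show "((\<lambda>x. \<phi> (g \<otimes> inv_into U \<phi> x \<otimes> inv g)) has_derivative Ad G U \<phi> g) (at (\<phi> \<one>))"
    by (rule Ad_has_derivative[OF charts])
qed

lemma linear_Ad: "linear (Ad G U \<phi> g)"
  using has_derivative_Ad has_derivative_linear by blast

lemma Ad_one: "Ad G U \<phi> \<one> = (\<lambda>v. v)"
proof -
  have "\<forall>\<^sub>F x in nhds (\<phi> \<one>). x \<in> \<phi> ` U"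
    using chart[OF U(1)] U(2) by (intro eventually_nhds_in_open) auto
  then have "\<forall>\<^sub>F x in nhds (\<phi> \<one>). x = \<phi> (\<one> \<otimes> inv_into U \<phi> x \<otimes> inv \<one>)"
    by (rule eventually_mono) (simp add: f_inv_into_f)
  then have "((\<lambda>x. \<phi> (\<one> \<otimes> inv_into U \<phi> x \<otimes> inv \<one>)) has_derivative (\<lambda>v. v)) (at (\<phi> \<one>))"
    by (rule has_derivative_transform_nhds[OF has_derivative_ident])
  then show ?thesis
    using has_derivative_Ad[of \<one>] has_derivative_unique by blast
qed

text \<open>This is the chain rule for a composite of two conjugations. Conjugation fixes the
  identity, so both derivatives are taken at the same point \<open>\<phi> \<one>\<close>.\<close>

lemma Ad_mult: "Ad G U \<phi> (g \<otimes> h) v = Ad G U \<phi> g (Ad G U \<phi> h v)"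
proof -
  let ?F = "\<lambda>g x. \<phi> (g \<otimes> inv_into U \<phi> x \<otimes> inv g)"
  have fix1: "?F h (\<phi> \<one>) = \<phi> \<one>"
    using chart_left_inv[OF U] by simp
  have "\<forall>\<^sub>F x in nhds (\<phi> \<one>). ?F g (?F h x) = ?F (g \<otimes> h) x"
    using conjugation_eventually[of h]
    by (rule eventually_mono) (simp add: chart_left_inv[OF U(1)] inv_mult_group m_assoc)
  moreover have "((\<lambda>x. ?F g (?F h x)) has_derivative (\<lambda>v. Ad G U \<phi> g (Ad G U \<phi> h v))) (at (\<phi> \<one>))"
    using has_derivative_compose[OF has_derivative_Ad[of h], of "?F g" "Ad G U \<phi> g"]
      has_derivative_Ad[of g] unfolding fix1 .
  ultimately have "(?F (g \<otimes> h) has_derivative (\<lambda>v. Ad G U \<phi> g (Ad G U \<phi> h v))) (at (\<phi> \<one>))"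
    by (rule has_derivative_transform_nhds[rotated])
  then have "Ad G U \<phi> (g \<otimes> h) = (\<lambda>v. Ad G U \<phi> g (Ad G U \<phi> h v))"
    using has_derivative_Ad has_derivative_unique by blast
  then show ?thesis
    by simp
qed

text \<open>With charts around \<open>g0\<close> and its inverse held fixed,
  \<open>Ad_in_charts\<close> writes \<open>Ad\<close> near \<open>g0\<close> through derivatives of
  two smooth maps whose base points move continuously with \<open>g\<close>.\<close>

lemma continuous_on_Ad: "continuous_on UNIV (\<lambda>g. Ad G U \<phi> g v)"
proof (intro continuous_at_imp_continuous_on ballI)
  fix g0
  obtain V \<psi> V' \<psi>' where V: "(V, \<psi>) \<in> atlas" "g0 \<in> V" and V': "(V', \<psi>') \<in> atlas" "inv g0 \<in> V'"
    using chart_around by metis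
  \<comment> \<open>\<open>S\<close> is the coordinate domain of inversion. Its openness is part of
    \<open>smooth_on\<close>, and this makes \<open>T\<close> an open neighbourhood of
    \<open>g0\<close> on which both charts can be used.\<close>
  define S where "S = {x \<in> \<psi> ` V. inv (inv_into V \<psi> x) \<in> V'}"
  define T where "T = V \<inter> \<psi> -` S"
  have smooth: "smooth_on S (\<lambda>x. \<psi>' (inv (inv_into V \<psi> x)))"
    unfolding S_def by (rule smooth_inv[OF V(1) V'(1)])
  then have "open S"
    by (simp add: smooth_on_def)
  then have "open T"
    unfolding T_def using continuous_open_preimage chart_continuous chart V(1) by metis
  have T: "g \<in> V" "inv g \<in> V'" if "g \<in> T" for g
  proof -
    show "g \<in> V"
      using that by (simp add: T_def)
    with that show "inv g \<in> V'"
      by (simp add: T_def S_def chart_left_inv[OF V(1)])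
  qed
  have "g0 \<in> T"
    using V V' chart_left_inv[OF V(1)] by (auto simp: T_def S_def)
  have c1: "continuous_on T \<psi>"
    using chart_continuous[OF V(1)] T(1) continuous_on_subset by blast
  have "continuous_on T (\<lambda>g. \<psi>' (inv (inv_into V \<psi> (\<psi> g))))"
    using continuous_on_compose2[OF smooth_on_continuous_on[OF smooth] c1] by (auto simp: T_def)
  then have c2: "continuous_on T (\<lambda>g. \<psi>' (inv g))"
    using T(1) by (simp add: chart_left_inv[OF V(1)] cong: continuous_on_cong)
  let ?m1 = "\<lambda>(x, y). \<psi> (inv_into V \<psi> x \<otimes> inv_into U \<phi> y)"
  let ?m2 = "\<lambda>(x, y). \<phi> (inv_into V \<psi> x \<otimes> inv_into V' \<psi>' y)"
  note inv = chart_left_inv[OF V(1)] chart_left_inv[OF V'(1)] chart_left_inv[OF U]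
  have "continuous_on T (\<lambda>g. frechet_derivative ?m2 (at (\<psi> g, \<psi>' (inv g)))
      (frechet_derivative ?m1 (at (\<psi> g, \<phi> \<one>)) (0, v), 0))"
    using T U(2)
    by (intro continuous_on_frechet_derivative[OF smooth_mult[OF V(1) V'(1) U(1)]]
        continuous_on_frechet_derivative[OF smooth_mult[OF V(1) U(1) V(1)]] continuous_intros c1 c2)
       (auto simp: inv)
  then have "continuous_on T (\<lambda>g. Ad G U \<phi> g v)"
    using Ad_in_charts[OF U V(1) T(1) V'(1) T(2)] by (simp cong: continuous_on_cong)
  then show "isCont (\<lambda>g. Ad G U \<phi> g v) g0"
    using \<open>open T\<close> \<open>g0 \<in> T\<close> continuous_on_eq_continuous_at by blast
qed

end

end

section \<open>Subexponential growth and Oseledets filtrations\<close>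

text \<open>The upper exponential growth rate is at most 0. Unlike a Lyapunov exponent, this makes
  sense for every sequence, whether or not a limit exists.\<close>

definition subexp_growth :: "(nat \<Rightarrow> real) \<Rightarrow> bool" where
  "subexp_growth a \<longleftrightarrow> (\<forall>e>0. \<forall>\<^sub>F n in sequentially. ln (a n) \<le> e * real n)"

lemma subexp_growthD:
  "subexp_growth a \<Longrightarrow> e > 0 \<Longrightarrow> \<forall>\<^sub>F n in sequentially. ln (a n) \<le> e * real n"
  by (simp add: subexp_growth_def)

text \<open>In one direction \<open>e * real n\<close> only grows when \<open>n\<close> is replaced
  by \<open>n + m\<close>. In the other, \<open>n + m\<close> is at most \<open>2 * n\<close> once
  \<open>n \<ge> m\<close>, and starting from \<open>e / 2\<close> absorbs the factor 2.\<close>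

lemma subexp_growth_shift: "subexp_growth (\<lambda>n. a (n + m)) \<longleftrightarrow> subexp_growth a"
proof
  assume a: "subexp_growth (\<lambda>n. a (n + m))"
  show "subexp_growth a"
    unfolding subexp_growth_def
  proof (intro allI impI)
    fix e :: real assume "e > 0"
    with a have "\<forall>\<^sub>F n in sequentially. ln (a (n + m)) \<le> e * real n"
      by (simp add: subexp_growth_def)
    moreover have "e * real n \<le> e * real (n + m)" for n
      using \<open>e > 0\<close> by simp
    ultimately have "\<forall>\<^sub>F n in sequentially. ln (a (n + m)) \<le> e * real (n + m)"
      using order_trans by (fastforce elim!: eventually_mono)
    then show "\<forall>\<^sub>F n in sequentially. ln (a n) \<le> e * real n"
      by (subst (asm) eventually_sequentially_seg)
  qed
next
  assume a: "subexp_growth a"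
  show "subexp_growth (\<lambda>n. a (n + m))"
    unfolding subexp_growth_def
  proof (intro allI impI)
    fix e :: real assume "e > 0"
    with subexp_growthD[OF a, of "e / 2"]
    have "\<forall>\<^sub>F n in sequentially. ln (a n) \<le> e / 2 * real n"
      by simp
    then have "\<forall>\<^sub>F n in sequentially. ln (a (n + m)) \<le> e / 2 * real (n + m)"
      by (subst eventually_sequentially_seg)
    with eventually_ge_at_top[of m]
    show "\<forall>\<^sub>F n in sequentially. ln (a (n + m)) \<le> e * real n"
    proof eventually_elim
      case (elim n)
      then have "e / 2 * real (n + m) \<le> e / 2 * (2 * real n)"
        using \<open>e > 0\<close> by (intro mult_left_mono) auto
      with elim show ?case by simp
    qed
  qed
qed

text \<open>Countably many tolerances suffice, which is what makes subexponential growth a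
  measurable condition.\<close>

lemma subexp_growth_iff_countable:
  "subexp_growth a \<longleftrightarrow> (\<forall>i::nat. \<forall>\<^sub>F n in sequentially. ln (a n) \<le> inverse (real (Suc i)) * real n)"
proof
  assume *: "\<forall>i::nat. \<forall>\<^sub>F n in sequentially. ln (a n) \<le> inverse (real (Suc i)) * real n"
  show "subexp_growth a"
    unfolding subexp_growth_def
  proof (intro allI impI)
    fix e :: real assume "e > 0"
    then obtain i where "inverse (real (Suc i)) < e"
      using reals_Archimedean by blast
    then have "inverse (real (Suc i)) * real n \<le> e * real n" for n
      by (intro mult_right_mono) auto
    then show "\<forall>\<^sub>F n in sequentially. ln (a n) \<le> e * real n"
      using *[rule_format, of i] order_trans by (fastforce elim!: eventually_mono)
  qed
qed (simp add: subexp_growth_def)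

lemma pred_subexp_growth [measurable]:
  assumes [measurable]: "\<And>n. f n \<in> borel_measurable M"
  shows "Measurable.pred M (\<lambda>x. subexp_growth (\<lambda>n. f n x))"
  unfolding subexp_growth_iff_countable by measurable

lemma subexp_growth_if_tendsto_nonpos:
  assumes "(\<lambda>n. ln (a n) / real n) \<longlonglongrightarrow> c" "c \<le> 0"
  shows "subexp_growth a"
  unfolding subexp_growth_def
proof (intro allI impI)
  fix e :: real assume "e > 0"
  then have "\<forall>\<^sub>F n in sequentially. ln (a n) / real n < e"
    using assms by (intro order_tendstoD(2)[OF assms(1)]) simp
  with eventually_gt_at_top[of 0] show "\<forall>\<^sub>F n in sequentially. ln (a n) \<le> e * real n"
    by eventually_elim (simp add: divide_simps)
qed

lemma not_subexp_growth_if_tendsto_pos: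
  assumes "(\<lambda>n. ln (a n) / real n) \<longlonglongrightarrow> c" "c > 0"
  shows "\<not> subexp_growth a"
proof
  assume "subexp_growth a"
  then have "\<forall>\<^sub>F n in sequentially. ln (a n) \<le> c / 2 * real n"
    using assms(2) by (intro subexp_growthD) simp_all
  moreover have "\<forall>\<^sub>F n in sequentially. c / 2 < ln (a n) / real n"
    using assms by (intro order_tendstoD(1)[OF assms(1)]) simp
  ultimately have "\<forall>\<^sub>F n::nat in sequentially. False"
    using eventually_gt_at_top[of 0] by eventually_elim (simp add: divide_simps)
  then show False
    by simp
qed

section \<open>Membership in the Oseledets subspace as a growth condition\<close>

lemma oseledets_filtration_antimono:
  assumes "oseledets_filtration E N A s \<gamma> V" "1 \<le> i" "i \<le> j" "j \<le> s + 1"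
  shows "V j \<subseteq> V i"
  using assms(3,4)
proof (induction rule: dec_induct)
  case (step j)
  moreover have "V (j + 1) \<subset> V j"
    using assms(1,2) step unfolding oseledets_filtration_def by simp
  ultimately show ?case
    by auto
qed simp

text \<open>The exponent of a nonzero vector is read off at the last step of the filtration that
  contains it.\<close>

lemma oseledets_filtration_exponent:
  assumes F: "oseledets_filtration E N A s \<gamma> V" and v: "v \<in> E" "v \<noteq> 0"
  obtains j where "j \<in> {1..s}" "v \<in> V j" "v \<notin> V (j + 1)"
    "(\<lambda>n. ln (N (A n v)) / real n) \<longlonglongrightarrow> \<gamma> j"
proof -
  let ?J = "{j \<in> {1..s + 1}. v \<in> V j}"
  define j where "j = Max ?J"
  have "1 \<in> ?J"
    using F v by (simp add: oseledets_filtration_def)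
  then have "j \<in> ?J"
    unfolding j_def by (intro Max_in) auto
  then have j: "1 \<le> j" "j \<le> s + 1" "v \<in> V j"
    by auto
  have "j \<noteq> s + 1"
    using F v j by (auto simp: oseledets_filtration_def)
  then have "j \<in> {1..s}"
    using j by simp
  moreover have "v \<notin> V (j + 1)"
  proof
    assume "v \<in> V (j + 1)"
    then have "j + 1 \<in> ?J"
      using \<open>j \<in> {1..s}\<close> by simp
    then have "j + 1 \<le> j"
      unfolding j_def by (intro Max_ge) auto
    then show False by simp
  qed
  moreover from this have "(\<lambda>n. ln (N (A n v)) / real n) \<longlonglongrightarrow> \<gamma> j"
    using F \<open>j \<in> {1..s}\<close> j(3) by (simp add: oseledets_filtration_def)
  ultimately show thesis
    using \<open>j \<in> {1..s}\<close> j(3) by (intro that)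
qed

lemma oseledets_subexp_subspace: "oseledets_subexp E N A U \<Longrightarrow> subspace U"
proof -
  assume "oseledets_subexp E N A U"
  then obtain s \<gamma> V where F: "oseledets_filtration E N A s \<gamma> V"
    and U: "U = (if \<exists>j\<in>{1..s}. \<gamma> j \<le> 0 then V (Min {j\<in>{1..s}. \<gamma> j \<le> 0}) else {0})"
    unfolding oseledets_subexp_def by blast
  have "Min {j\<in>{1..s}. \<gamma> j \<le> 0} \<in> {j\<in>{1..s}. \<gamma> j \<le> 0}" if "\<exists>j\<in>{1..s}. \<gamma> j \<le> 0"
    using that by (intro Min_in) auto
  then show "subspace U"
    using F U by (cases "\<exists>j\<in>{1..s}. \<gamma> j \<le> 0") (simp_all add: oseledets_filtration_def)
qed

text \<open>Take for \<open>c\<close> the exponent \<open>\<gamma> j\<close> at the last step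
  \<open>j\<close> containing \<open>v\<close>. As the exponents decrease, \<open>\<gamma> j\<close>
  is non-positive exactly when \<open>j\<close> is at or beyond the first index with non-positive
  exponent, that is, when \<open>v\<close> lies in \<open>U\<close>.\<close>

lemma oseledets_subexp_exponent:
  assumes "oseledets_subexp E N A U" "v \<in> E" "v \<noteq> 0"
  obtains c where "(\<lambda>n. ln (N (A n v)) / real n) \<longlonglongrightarrow> c" "v \<in> U \<longleftrightarrow> c \<le> 0"
proof -
  obtain s \<gamma> V where F: "oseledets_filtration E N A s \<gamma> V"
    and U: "U = (if \<exists>j\<in>{1..s}. \<gamma> j \<le> 0 then V (Min {j\<in>{1..s}. \<gamma> j \<le> 0}) else {0})"
    using assms(1) unfolding oseledets_subexp_def by blast
  obtain j where j: "j \<in> {1..s}" "v \<in> V j" "v \<notin> V (j + 1)"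
    and lim: "(\<lambda>n. ln (N (A n v)) / real n) \<longlonglongrightarrow> \<gamma> j"
    by (rule oseledets_filtration_exponent[OF F assms(2,3)])
  let ?J = "{j\<in>{1..s}. \<gamma> j \<le> 0}"
  let ?m = "Min ?J"
  have "v \<in> U \<longleftrightarrow> \<gamma> j \<le> 0"
  proof (cases "\<exists>j\<in>{1..s}. \<gamma> j \<le> 0")
    case True
    then have m: "?m \<in> ?J"
      by (intro Min_in) auto
    show ?thesis
    proof
      assume "\<gamma> j \<le> 0"
      then have "?m \<le> j"
        using j by (intro Min_le) auto
      then show "v \<in> U"
        using oseledets_filtration_antimono[OF F, of ?m j] m j U True by auto
    next
      assume "v \<in> U"
      \<comment> \<open>Otherwise \<open>V ?m\<close> would be contained in
        \<open>V (j + 1)\<close>, which omits \<open>v\<close>.\<close>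
      then have "\<not> j < ?m"
        using oseledets_filtration_antimono[OF F, of "j + 1" ?m] m j U True by auto
      then have "\<gamma> j \<le> \<gamma> ?m"
        using F m j unfolding oseledets_filtration_def
        by (metis (lifting) less_le_not_le linorder_neqE_nat mem_Collect_eq order_refl)
      then show "\<gamma> j \<le> 0"
        using m by auto
    qed
  next
    case False
    then show ?thesis
      using U j(1) assms(3) by auto
  qed
  with lim show thesis
    by (rule that)
qed

text \<open>Since the growth rate of each nonzero vector has a limit, its sign decides both sides.
  The right-hand side no longer mentions a filtration, so its probability can be studied for a fixed
  \<open>v\<close>.\<close>

lemma oseledets_subexp_mem_iff:
  assumes "oseledets_subexp E N A U" "v \<in> E" "\<And>n. N (A n 0) = 0"
  shows "v \<in> U \<longleftrightarrow> subexp_growth (\<lambda>n. N (A n v))"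
proof (cases "v = 0")
  case True
  \<comment> \<open>The zero vector grows subexponentially because of the convention
    \<open>ln 0 = 0\<close>.\<close>
  then show ?thesis
    using subspace_0[OF oseledets_subexp_subspace[OF assms(1)]] assms(3)
    by (simp add: subexp_growth_def)
next
  case False
  obtain c where "(\<lambda>n. ln (N (A n v)) / real n) \<longlonglongrightarrow> c" "v \<in> U \<longleftrightarrow> c \<le> 0"
    by (rule oseledets_subexp_exponent[OF assms(1,2) False])
  then show ?thesis
    using subexp_growth_if_tendsto_nonpos not_subexp_growth_if_tendsto_pos by (meson not_le)
qed

lemma oseledets_subexp_liminf_pos:
  assumes "oseledets_subexp E N A U" "v \<in> E" "v \<notin> U"
  shows "liminf (\<lambda>n. ereal (ln (N (A n v)) / real n)) > 0"
proof -
  have "v \<noteq> 0"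
    using assms(3) subspace_0[OF oseledets_subexp_subspace[OF assms(1)]] by auto
  then obtain c where c: "(\<lambda>n. ln (N (A n v)) / real n) \<longlonglongrightarrow> c" "v \<in> U \<longleftrightarrow> c \<le> 0"
    using oseledets_subexp_exponent[OF assms(1,2)] by blast
  have "liminf (\<lambda>n. ereal (ln (N (A n v)) / real n)) = ereal c"
    using c(1) by (intro lim_imp_Liminf) simp_all
  then show ?thesis
    using c(2) assms(3) by simp
qed

section \<open>Linear random walks\<close>

text \<open>Expanding in an orthonormal basis of \<open>E\<close> bounds \<open>N\<close> by a
  multiple of the Euclidean norm, and the triangle inequality turns this bound into a Lipschitz
  estimate.\<close>

lemma norm_on_continuous_on:
  fixes E :: "'v::euclidean_space set"
  assumes E: "subspace E" and N: "norm_on E N"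
  shows "continuous_on E N"
proof -
  obtain B where B: "B \<subseteq> E" "pairwise orthogonal B" "\<And>x. x \<in> B \<Longrightarrow> norm x = 1"
    "independent B" "span B = E"
    using orthonormal_basis_subspace[OF E] by metis
  have fin: "finite B"
    using B(4) independent_imp_finite by blast
  have N0: "N 0 = 0"
    using N subspace_0[OF E] by (auto simp: norm_on_def)
  have sum_le: "N (sum f A) \<le> (\<Sum>b\<in>A. N (f b))" if "finite A" "\<And>b. b \<in> A \<Longrightarrow> f b \<in> E" for f :: "'v \<Rightarrow> 'v" and A
    using that
  proof (induction rule: finite_induct)
    case (insert a A)
    have "N (f a + sum f A) \<le> N (f a) + N (sum f A)"
      using N insert.prems subspace_sum[OF E, of A f] by (auto simp: norm_on_def)
    with insert show ?case by force
  qed (simp add: N0)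
  define C where "C = (\<Sum>b\<in>B. N b)"
  have "C \<ge> 0"
    unfolding C_def using N B(1) by (intro sum_nonneg) (auto simp: norm_on_def)
  have bound: "N x \<le> C * norm x" if "x \<in> E" for x
  proof -
    have "N x = N (\<Sum>b\<in>B. (x \<bullet> b) *\<^sub>R b)"
      using orthonormal_basis_expand[OF B(2,3) _ fin, of x] that B(5) by simp
    also have "\<dots> \<le> (\<Sum>b\<in>B. N ((x \<bullet> b) *\<^sub>R b))"
      using B(1) E by (intro sum_le fin) (auto simp: subspace_scale)
    also have "\<dots> \<le> (\<Sum>b\<in>B. N b * norm x)"
    proof (rule sum_mono)
      fix b assume b: "b \<in> B"
      have "N ((x \<bullet> b) *\<^sub>R b) = \<bar>x \<bullet> b\<bar> * N b" "0 \<le> N b"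
        using N b B(1) by (auto simp: norm_on_def)
      moreover have "\<bar>x \<bullet> b\<bar> \<le> norm x"
        using Cauchy_Schwarz_ineq2[of x b] B(3)[OF b] by simp
      ultimately show "N ((x \<bullet> b) *\<^sub>R b) \<le> N b * norm x"
        by (simp add: mult.commute mult_left_mono)
    qed
    finally show ?thesis
      by (simp add: C_def sum_distrib_right)
  qed
  have le: "N x - N y \<le> C * dist x y" if "x \<in> E" "y \<in> E" for x y
  proof -
    have "x - y \<in> E"
      using that E by (simp add: subspace_diff)
    moreover from this have "N (y + (x - y)) \<le> N y + N (x - y)"
      using N that unfolding norm_on_def by blast
    ultimately show ?thesis
      using bound[of "x - y"] by (simp add: dist_norm)
  qed
  have "C-lipschitz_on E N"
  proof (rule lipschitz_onI[OF _ \<open>C \<ge> 0\<close>])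
    show "dist (N x) (N y) \<le> C * dist x y" if "x \<in> E" "y \<in> E" for x y
      using le[OF that] le[OF that(2,1)] by (simp add: dist_real_def dist_commute[of y x])
  qed
  then show ?thesis
    by (rule lipschitz_on_continuous_on)
qed

lemma ennreal_idempotent:
  fixes a :: ennreal
  assumes "a * a = a" "a \<noteq> 0" "a \<noteq> \<top>"
  shows "a = 1"
  using assms ennreal_mult_cancel_left[of a a 1] by auto

text \<open>The representation acts on the whole ambient space, while \<open>N\<close> is a norm
  only on the invariant subspace \<open>E\<close>. In the application the ambient space models the
  full exterior algebra and \<open>E\<close> is one exterior power. The product measure
  \<open>S\<close> is the law of the sequence of increments.\<close>

locale linear_random_walk = sequence_space \<mu> + group G
  for \<mu> :: "'g::topological_space measure" and G :: "'g monoid" (structure) +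
  fixes \<rho> :: "'g \<Rightarrow> 'v::euclidean_space \<Rightarrow> 'v" and E :: "'v set" and N :: "'v \<Rightarrow> real"
  assumes sets_mu: "sets \<mu> = sets borel"
    and carrier_UNIV: "carrier G = UNIV"
    and linear_rep: "linear (\<rho> g)"
    and rep_one: "\<rho> \<one> v = v"
    and rep_mult: "\<rho> (g \<otimes> h) v = \<rho> g (\<rho> h v)"
    and continuous_on_rep: "continuous_on UNIV (\<lambda>g. \<rho> g v)"
    and subspace_E: "subspace E"
    and rep_E: "v \<in> E \<Longrightarrow> \<rho> g v \<in> E"
    and norm_on_E: "norm_on E N"
begin

lemma space_mu: "space \<mu> = UNIV"
  using sets_eq_imp_space_eq[OF sets_mu] by simp

lemma space_S [simp]: "space S = UNIV"
  by (simp add: space_PiM space_mu)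

lemma in_carrier [simp]: "g \<in> carrier G"
  by (simp add: carrier_UNIV)

lemma rep_inv: "\<rho> (inv g) (\<rho> g v) = v"
  by (simp add: rep_mult[symmetric] rep_one)

lemma rep_zero [simp]: "\<rho> g 0 = 0"
  by (rule linear_0[OF linear_rep])

lemma rep_eq_0_iff [simp]: "\<rho> g v = 0 \<longleftrightarrow> v = 0"
  using rep_inv[of g v] by auto

text \<open>Continuity is given only for a fixed vector; expanding the varying vector in a basis
  reduces to that case.\<close>

lemma measurable_rep:
  assumes [measurable]: "f \<in> measurable M \<mu>" "w \<in> borel_measurable M"
  shows "(\<lambda>x. \<rho> (f x) (w x)) \<in> borel_measurable M"
proof -
  have [measurable]: "(\<lambda>g. \<rho> g i) \<in> borel_measurable \<mu>" for i
    using borel_measurable_continuous_onI[OF continuous_on_rep] sets_mu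
    by (simp cong: measurable_cong_sets)
  have rep_expand: "\<rho> (f x) (w x) = (\<Sum>i\<in>Basis. (w x \<bullet> i) *\<^sub>R \<rho> (f x) i)" for x
  proof -
    have "\<rho> (f x) (\<Sum>i\<in>Basis. (w x \<bullet> i) *\<^sub>R i) = (\<Sum>i\<in>Basis. (w x \<bullet> i) *\<^sub>R \<rho> (f x) i)"
      by (simp only: linear_sum[OF linear_rep] linear_cmul[OF linear_rep])
    then show ?thesis
      by (simp only: euclidean_representation)
  qed
  show ?thesis
    unfolding rep_expand by measurable
qed

text \<open>The induction follows the moving vector rather than the group element, so that only the
  action has to be measurable.\<close>

lemma measurable_walk: "(\<lambda>b. \<rho> (walk G b n) v) \<in> borel_measurable S"
proof (induction n)
  case (Suc n)
  have "(\<lambda>b. \<rho> (b n) (\<rho> (walk G b n) v)) \<in> borel_measurable S"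
    by (rule measurable_rep[OF _ Suc]) measurable
  then show ?case
    by (simp add: rep_mult)
qed simp

text \<open>\<open>comb_seq m \<omega> \<omega>'\<close> plays the first \<open>m\<close> letters of
  \<open>\<omega>\<close> and then all of \<open>\<omega>'\<close>. Later increments multiply on the
  left, so the walk factors at time \<open>m\<close>.\<close>

lemma walk_comb_seq: "walk G (comb_seq m \<omega> \<omega>') (n + m) = walk G \<omega>' n \<otimes> walk G \<omega> m"
proof (induction n)
  case 0
  have "walk G (comb_seq m \<omega> \<omega>') k = walk G \<omega> k" if "k \<le> m" for k
    using that by (induction k) (simp_all add: comb_seq_less)
  then show ?case
    by simp
next
  case (Suc n)
  then show ?case
    by (simp add: comb_seq_add m_assoc)
qed

text \<open>For almost every \<open>b\<close> this is the event that \<open>v\<close> lies in the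
  Oseledets subspace, stated so that it is defined for all \<open>b\<close>. Its probability is the
  function \<open>h\<close> of the introduction.\<close>

definition slow :: "'v \<Rightarrow> (nat \<Rightarrow> 'g) set" where
  "slow v = {b. subexp_growth (\<lambda>n. N (\<rho> (walk G b n) v))}"

lemma sets_slow [measurable]:
  assumes "v \<in> E"
  shows "slow v \<in> sets S"
proof -
  \<comment> \<open>As \<open>N\<close> is continuous only on \<open>E\<close>, it is cut off to
    zero outside; the orbit of \<open>v\<close> never leaves \<open>E\<close>, so nothing changes
    along it.\<close>
  have [measurable]: "(\<lambda>x. indicator E x *\<^sub>R N x) \<in> borel_measurable borel"
    using norm_on_continuous_on[OF subspace_E norm_on_E] closed_subspace[OF subspace_E]
    by (intro borel_measurable_continuous_on_indicator) auto
  note measurable_walk [measurable]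
  have "Measurable.pred S (\<lambda>b. subexp_growth (\<lambda>n. (\<lambda>x. indicator E x *\<^sub>R N x) (\<rho> (walk G b n) v)))"
    by measurable
  then show ?thesis
    using rep_E[OF assms] by (simp add: slow_def pred_def)
qed

text \<open>The growth rate forgets the first \<open>m\<close> steps except for the vector they lead
  to.\<close>

lemma comb_seq_in_slow_iff: "comb_seq m \<omega> \<omega>' \<in> slow v \<longleftrightarrow> \<omega>' \<in> slow (\<rho> (walk G \<omega> m) v)"
proof -
  have "subexp_growth (\<lambda>n. N (\<rho> (walk G (comb_seq m \<omega> \<omega>') n) v)) \<longleftrightarrow>
      subexp_growth (\<lambda>n. N (\<rho> (walk G (comb_seq m \<omega> \<omega>') (n + m)) v))"
    by (rule subexp_growth_shift[symmetric])
  then show ?thesis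
    by (simp add: slow_def walk_comb_seq rep_mult)
qed

text \<open>This is the Markov property at time \<open>m\<close>: concatenating two independent
  sequences by \<open>comb_seq\<close> preserves \<open>S\<close>, and Fubini integrates over the
  second one first. The condition on \<open>C\<close> says that it depends only on the first
  \<open>m\<close> letters.\<close>

lemma
  assumes v: "v \<in> E"
  shows measurable_emeasure_slow_walk: "(\<lambda>\<omega>. emeasure S (slow (\<rho> (walk G \<omega> m) v))) \<in> borel_measurable S"
    and emeasure_slow_Int: "C \<in> sets S \<Longrightarrow> (\<And>\<omega> \<omega>'. comb_seq m \<omega> \<omega>' \<in> C \<longleftrightarrow> \<omega> \<in> C) \<Longrightarrow>
      emeasure S (slow v \<inter> C) = (\<integral>\<^sup>+\<omega>. emeasure S (slow (\<rho> (walk G \<omega> m) v)) * indicator C \<omega> \<partial>S)"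
proof -
  let ?f = "\<lambda>(\<omega>, \<omega>'). comb_seq m \<omega> \<omega>'"
  have pair: "?f -` X \<inter> space (S \<Otimes>\<^sub>M S) \<in> sets (S \<Otimes>\<^sub>M S)" if "X \<in> sets S" for X
    by (rule measurable_sets[OF measurable_comb_seq that])
  have slice: "Pair \<omega> -` (?f -` slow v \<inter> space (S \<Otimes>\<^sub>M S)) = slow (\<rho> (walk G \<omega> m) v)" for \<omega>
    by (auto simp: comb_seq_in_slow_iff space_pair_measure)
  show "(\<lambda>\<omega>. emeasure S (slow (\<rho> (walk G \<omega> m) v))) \<in> borel_measurable S"
    using P.measurable_emeasure_Pair[OF pair[OF sets_slow[OF v]]] unfolding slice .
  assume C: "C \<in> sets S" "\<And>\<omega> \<omega>'. comb_seq m \<omega> \<omega>' \<in> C \<longleftrightarrow> \<omega> \<in> C"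
  have "Pair \<omega> -` (?f -` (slow v \<inter> C) \<inter> space (S \<Otimes>\<^sub>M S)) =
      (if \<omega> \<in> C then slow (\<rho> (walk G \<omega> m) v) else {})" for \<omega>
    by (auto simp: comb_seq_in_slow_iff C(2) space_pair_measure)
  note slice_Int = this
  have "emeasure S (slow v \<inter> C) = emeasure (distr (S \<Otimes>\<^sub>M S) S ?f) (slow v \<inter> C)"
    by (simp only: PiM_comb_seq)
  also have "\<dots> = emeasure (S \<Otimes>\<^sub>M S) (?f -` (slow v \<inter> C) \<inter> space (S \<Otimes>\<^sub>M S))"
    using C v by (intro emeasure_distr measurable_comb_seq) auto
  also have "\<dots> = (\<integral>\<^sup>+\<omega>. emeasure S (Pair \<omega> -` (?f -` (slow v \<inter> C) \<inter> space (S \<Otimes>\<^sub>M S))) \<partial>S)"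
    using C v by (intro P.emeasure_pair_measure_alt pair) auto
  also have "\<dots> = (\<integral>\<^sup>+\<omega>. emeasure S (slow (\<rho> (walk G \<omega> m) v)) * indicator C \<omega> \<partial>S)"
    unfolding slice_Int by (intro nn_integral_cong) (auto simp: indicator_def)
  finally show "emeasure S (slow v \<inter> C) = (\<integral>\<^sup>+\<omega>. emeasure S (slow (\<rho> (walk G \<omega> m) v)) * indicator C \<omega> \<partial>S)" .
qed

text \<open>By the Markov property with \<open>C = UNIV\<close>, the mean of \<open>?h\<close> is
  \<open>?M\<close>. As \<open>?h\<close> never exceeds this finite value, \<open>?M - ?h\<close> is
  a nonnegative function with integral 0.\<close>

lemma maximum_principle:
  assumes v: "v \<in> E" "v \<noteq> 0"
    and max: "\<And>w. w \<in> E \<Longrightarrow> w \<noteq> 0 \<Longrightarrow> emeasure S (slow w) \<le> emeasure S (slow v)"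
  shows "AE \<omega> in S. emeasure S (slow (\<rho> (walk G \<omega> m) v)) = emeasure S (slow v)"
proof -
  let ?M = "emeasure S (slow v)"
  let ?h = "\<lambda>\<omega>. emeasure S (slow (\<rho> (walk G \<omega> m) v))"
  note measurable_emeasure_slow_walk[OF v(1), of m, measurable]
  have le: "?h \<omega> \<le> ?M" for \<omega>
    using v by (intro max) (auto simp: rep_E)
  have int: "(\<integral>\<^sup>+\<omega>. ?h \<omega> \<partial>S) = ?M"
    using emeasure_slow_Int[OF v(1), of UNIV m] sets.top[of S] by simp
  have fin: "?M \<noteq> \<infinity>"
    by simp
  have "(\<integral>\<^sup>+\<omega>. ?M - ?h \<omega> \<partial>S) = (\<integral>\<^sup>+\<omega>. ?M \<partial>S) - (\<integral>\<^sup>+\<omega>. ?h \<omega> \<partial>S)"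
    using le fin by (intro nn_integral_diff) (auto simp: int)
  also have "\<dots> = 0"
    using fin by (simp add: int P.emeasure_space_1[simplified])
  finally have "AE \<omega> in S. ?M - ?h \<omega> = 0"
    by (subst (asm) nn_integral_0_iff_AE) auto
  then show ?thesis
  proof eventually_elim
    case (elim \<omega>)
    then have "?M \<le> ?h \<omega>"
      using fin by (simp add: diff_eq_0_iff_ennreal)
    with le[of \<omega>] show ?case by simp
  qed
qed

text \<open>A cylinder depends on finitely many letters, so the Markov property and the maximum
  principle make \<open>slow v\<close> independent of it. Cylinders determine a finite measure,
  hence \<open>slow v\<close> is independent of itself and its probability is idempotent.\<close>

lemma zero_one_law:
  assumes v: "v \<in> E" "v \<noteq> 0"
    and max: "\<And>w. w \<in> E \<Longrightarrow> w \<noteq> 0 \<Longrightarrow> emeasure S (slow w) \<le> emeasure S (slow v)"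
    and pos: "emeasure S (slow v) \<noteq> 0"
  shows "emeasure S (slow v) = 1"
proof -
  let ?M = "emeasure S (slow v)"
  note sets_slow[OF v(1), measurable]
  have eq: "density S (indicator (slow v)) = scale_measure ?M S"
  proof (rule measure_eqI_PiM_infinite)
    show "finite_measure (density S (indicator (slow v)))"
      using sets.top[of S] by (intro finite_measureI) (simp add: emeasure_density)
    fix A and J :: "nat set"
    assume J: "finite J" "\<And>i. i \<in> J \<Longrightarrow> A i \<in> sets \<mu>"
    let ?C = "emb UNIV J (Pi\<^sub>E J A)"
    have C [measurable]: "?C \<in> sets S"
      using J by (intro sets_PiM_I) auto
    obtain m where m: "\<And>j. j \<in> J \<Longrightarrow> j < m"
      using J(1) by (auto simp: finite_nat_set_iff_bounded)
    have "comb_seq m \<omega> \<omega>' \<in> ?C \<longleftrightarrow> \<omega> \<in> ?C" for \<omega> \<omega>'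
    proof -
      have "\<omega> \<in> ?C \<longleftrightarrow> (\<forall>j\<in>J. \<omega> j \<in> A j)" for \<omega>
        by (simp add: prod_emb_iff space_mu PiE_iff)
      then show ?thesis
        using m by (simp add: comb_seq_less)
    qed
    then have "emeasure S (slow v \<inter> ?C) = (\<integral>\<^sup>+\<omega>. emeasure S (slow (\<rho> (walk G \<omega> m) v)) * indicator ?C \<omega> \<partial>S)"
      by (rule emeasure_slow_Int[OF v(1) C])
    also have "\<dots> = (\<integral>\<^sup>+\<omega>. ?M * indicator ?C \<omega> \<partial>S)"
      using maximum_principle[OF v max, of m] by (intro nn_integral_cong_AE) auto
    also have "\<dots> = ?M * emeasure S ?C"
      by (simp add: nn_integral_cmult)
    finally show "emeasure (density S (indicator (slow v))) ?C = emeasure (scale_measure ?M S) ?C"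
      by (simp add: emeasure_restricted)
  qed simp_all
  have "emeasure (density S (indicator (slow v))) (slow v) = ?M"
    by (simp add: emeasure_restricted)
  then have "?M * ?M = ?M"
    unfolding eq emeasure_scale_measure .
  then show ?thesis
    using pos P.emeasure_finite by (rule ennreal_idempotent)
qed

section \<open>Maximisers of the probability of slow growth\<close>

context
  fixes W :: "'v set"
  assumes slow_subspace: "AE b in S. \<exists>V. subspace V \<and> (\<forall>w\<in>E. w \<in> V \<longleftrightarrow> b \<in> slow w) \<and> W \<inter> V = {0}"
begin

text \<open>Scaling reduces to the unit sphere of \<open>E\<close>, which is compact. A maximising
  sequence has a convergent subsequence, and its limit is a maximiser by upper semicontinuity: when
  infinitely many of its terms lie in the closed set \<open>V\<close>, so does the limit.\<close>

lemma exists_maximal: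
  assumes "E \<noteq> {0}"
  obtains v where "v \<in> E" "v \<noteq> 0"
    "\<And>w. w \<in> E \<Longrightarrow> w \<noteq> 0 \<Longrightarrow> emeasure S (slow w) \<le> emeasure S (slow v)"
proof -
  let ?h = "\<lambda>v. measure S (slow v)"
  let ?K = "E \<inter> sphere 0 1"
  have normalize: "(1 / norm w) *\<^sub>R w \<in> ?K \<and> ?h ((1 / norm w) *\<^sub>R w) = ?h w" if w: "w \<in> E" "w \<noteq> 0" for w
  proof -
    let ?u = "(1 / norm w) *\<^sub>R w"
    have u: "?u \<in> E"
      using w subspace_E by (simp add: subspace_scale)
    have "AE b in S. b \<in> slow ?u \<longleftrightarrow> b \<in> slow w"
      using slow_subspace
    proof eventually_elim
      case (elim b)
      then obtain V where V: "subspace V" "\<forall>w\<in>E. w \<in> V \<longleftrightarrow> b \<in> slow w"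
        by (elim exE conjE) (rule that)
      have "?u \<in> V \<longleftrightarrow> w \<in> V"
        using subspace_scale[OF V(1), of ?u "norm w"] subspace_scale[OF V(1), of w "1 / norm w"] w(2) by auto
      then show ?case
        using V(2) w(1) u by blast
    qed
    then have "?h ?u = ?h w"
      using u w by (intro P.finite_measure_eq_AE) auto
    then show ?thesis
      using u w(2) by simp
  qed
  obtain w0 where "w0 \<in> E" "w0 \<noteq> 0"
    using assms subspace_0[OF subspace_E] by blast
  then have K: "?K \<noteq> {}"
    using normalize by blast
  define M where "M = (SUP u\<in>?K. ?h u)"
  have bdd: "bdd_above (?h ` ?K)"
    by (intro bdd_aboveI2[of _ _ 1]) simp
  have "\<exists>u\<in>?K. M - inverse (real (Suc n)) < ?h u" for n
    using less_cSUP_iff[OF K bdd, of "M - inverse (real (Suc n))"] by (simp add: M_def)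
  then obtain u where u: "\<And>n. u n \<in> ?K" "\<And>n. M - inverse (real (Suc n)) < ?h (u n)"
    by metis
  have "compact ?K"
    using closed_subspace[OF subspace_E] by (intro closed_Int_compact) auto
  then obtain v r where v: "v \<in> ?K" and r: "strict_mono r" "(u \<circ> r) \<longlonglongrightarrow> v"
    using u(1) unfolding compact_def by metis
  have [measurable]: "slow v \<in> sets S" "slow (u n) \<in> sets S" for n
    using v u(1)[of n] by (auto intro: sets_slow)
  \<comment> \<open>The intersection of the sets \<open>?D n\<close> is the event that infinitely
    many of the vectors \<open>u (r m)\<close> are slow.\<close>
  let ?D = "\<lambda>n. \<Union>m\<in>{n..}. slow (u (r m))"
  have D: "range ?D \<subseteq> sets S" "decseq ?D"
    by (auto simp: decseq_def intro: order_trans)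
  have "AE b in S. b \<in> (\<Inter>n. ?D n) \<longrightarrow> b \<in> slow v"
    using slow_subspace
  proof eventually_elim
    case (elim b)
    then obtain V where V: "subspace V" "\<forall>w\<in>E. w \<in> V \<longleftrightarrow> b \<in> slow w"
      by (elim exE conjE) (rule that)
    show ?case
    proof
      assume "b \<in> (\<Inter>n. ?D n)"
      then have freq: "\<exists>m\<ge>n. u (r m) \<in> V" for n
        using V(2) u(1) by fastforce
      have "v \<in> V"
      proof (rule ccontr)
        assume "v \<notin> V"
        then have "\<forall>\<^sub>F m in sequentially. (u \<circ> r) m \<in> - V"
          using closed_subspace[OF V(1)] by (intro topological_tendstoD[OF r(2)]) auto
        then show False
          using freq by (auto simp: eventually_sequentially)
      qed
      then show "b \<in> slow v"
        using V(2) v by blast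
    qed
  qed
  then have "measure S (\<Inter>n. ?D n) \<le> ?h v"
    by (intro P.finite_measure_mono_AE) auto
  moreover have "M \<le> measure S (\<Inter>n. ?D n)"
  proof (rule LIMSEQ_le)
    show "(\<lambda>n. M - inverse (real (Suc n))) \<longlonglongrightarrow> M"
      using LIMSEQ_inverse_real_of_nat_add_minus[of M] by simp
    show "(\<lambda>n. measure S (?D n)) \<longlonglongrightarrow> measure S (\<Inter>n. ?D n)"
      using D by (rule P.finite_Lim_measure_decseq)
    have "M - inverse (real (Suc n)) \<le> measure S (?D n)" for n
    proof -
      have "inverse (real (Suc (r n))) \<le> inverse (real (Suc n))"
        using seq_suble[OF r(1), of n] by simp
      then have "M - inverse (real (Suc n)) \<le> ?h (u (r n))"
        using u(2)[of "r n"] by linarith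
      also have "\<dots> \<le> measure S (?D n)"
        using D(1) by (intro P.finite_measure_mono) auto
      finally show ?thesis .
    qed
    then show "\<exists>k. \<forall>n\<ge>k. M - inverse (real (Suc n)) \<le> measure S (?D n)"
      by blast
  qed
  ultimately have max: "M \<le> ?h v"
    by simp
  show thesis
  proof (rule that[of v])
    show "v \<in> E" "v \<noteq> 0"
      using v by auto
    fix w assume w: "w \<in> E" "w \<noteq> 0"
    have "?h w \<le> M"
      using normalize[OF w] cSUP_upper[OF _ bdd] unfolding M_def by metis
    then show "emeasure S (slow w) \<le> emeasure S (slow v)"
      using max by (simp add: P.emeasure_eq_measure)
  qed
qed

section \<open>The invariant subspace of almost surely slow vectors\<close>

definition almost_surely_slow :: "'v set" where
  "almost_surely_slow = {v \<in> E. AE b in S. b \<in> slow v}"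

lemma almost_surely_slow_iff: "v \<in> almost_surely_slow \<longleftrightarrow> v \<in> E \<and> emeasure S (slow v) = 1"
proof (cases "v \<in> E")
  case True
  have "(AE b in S. b \<in> slow v) \<longleftrightarrow> measure S (slow v) = 1"
    by (rule P.AE_in_set_eq_1[OF sets_slow[OF True]])
  with True show ?thesis
    by (simp add: almost_surely_slow_def P.emeasure_eq_measure)
qed (simp add: almost_surely_slow_def)

lemma subspace_almost_surely_slow: "subspace almost_surely_slow"
proof (rule subspaceI)
  \<comment> \<open>Almost surely the slow vectors of \<open>E\<close> are those of one subspace, so
    anything in \<open>E\<close> built linearly from two almost surely slow vectors is almost surely
    slow. Scalar multiples use this with \<open>y = x\<close>.\<close>
  have good: "v \<in> almost_surely_slow"
    if "v \<in> E" "\<And>V. subspace V \<Longrightarrow> x \<in> V \<Longrightarrow> y \<in> V \<Longrightarrow> v \<in> V" "x \<in> almost_surely_slow" "y \<in> almost_surely_slow"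
    for v x y
  proof -
    have "AE b in S. b \<in> slow x" "AE b in S. b \<in> slow y"
      using that by (auto simp: almost_surely_slow_def)
    then have "AE b in S. b \<in> slow v"
      using slow_subspace
    proof eventually_elim
      case (elim b)
      then show ?case
        using that by (auto simp: almost_surely_slow_def)
    qed
    then show ?thesis
      using that by (simp add: almost_surely_slow_def)
  qed
  have "AE b in S. b \<in> slow 0"
    using slow_subspace
  proof eventually_elim
    case (elim b)
    then show ?case
      using subspace_0[OF subspace_E] by (metis subspace_0)
  qed
  then show "0 \<in> almost_surely_slow"
    using subspace_0[OF subspace_E] by (simp add: almost_surely_slow_def)
  show "x + y \<in> almost_surely_slow" if "x \<in> almost_surely_slow" "y \<in> almost_surely_slow" for x y
  proof (rule good[OF _ _ that])
    show "x + y \<in> E"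
      using that subspace_E by (simp add: almost_surely_slow_def subspace_add)
  qed (rule subspace_add)
  show "c *\<^sub>R x \<in> almost_surely_slow" if "x \<in> almost_surely_slow" for c x
  proof (rule good[OF _ _ that that])
    show "c *\<^sub>R x \<in> E"
      using that subspace_E by (simp add: almost_surely_slow_def subspace_scale)
  qed (rule subspace_scale)
qed

lemma closed_stabilizes: "closed {g. \<rho> g w \<in> almost_surely_slow}"
proof -
  have "closed ((\<lambda>g. \<rho> g w) -` almost_surely_slow)"
    by (intro closed_vimage continuous_on_rep closed_subspace subspace_almost_surely_slow)
  then show ?thesis
    by (simp add: vimage_def)
qed

text \<open>Probability 1 is maximal, so the maximum principle at time 1 shows that almost every
  increment keeps \<open>w\<close> in the subspace. The exceptional increments form an open null
  set, which cannot meet the support.\<close>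

lemma support_stabilizes:
  assumes w: "w \<in> almost_surely_slow" and g: "g \<in> measure_support \<mu>"
  shows "\<rho> g w \<in> almost_surely_slow"
proof (cases "w = 0")
  case True
  then show ?thesis
    using subspace_0[OF subspace_almost_surely_slow] by simp
next
  case False
  have 1: "w \<in> E" "emeasure S (slow w) = 1"
    using w by (auto simp: almost_surely_slow_iff)
  let ?F = "{g. \<rho> g w \<in> almost_surely_slow}"
  have F: "?F \<in> sets \<mu>"
    using closed_stabilizes by (simp add: sets_mu)
  have "AE \<omega> in S. emeasure S (slow (\<rho> (walk G \<omega> 1) w)) = 1"
    using maximum_principle[OF 1(1) False, of 1] P.emeasure_le_1 1(2) by simp
  then have ae_F: "AE \<omega> in S. \<omega> 0 \<in> ?F"
    using 1(1) by (simp add: almost_surely_slow_iff rep_E)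
  \<comment> \<open>The first increment has law \<open>\<mu>\<close>, which transfers the almost
    sure statement from sequences to group elements.\<close>
  have distr_0: "distr S \<mu> (\<lambda>\<omega>. \<omega> 0) = \<mu>"
    using PiM_component[of 0] by simp
  from ae_F have "AE g in distr S \<mu> (\<lambda>\<omega>. \<omega> 0). g \<in> ?F"
    using F by (subst AE_distr_iff) (auto simp: space_mu)
  then have "AE g in \<mu>. g \<in> ?F"
    unfolding distr_0 .
  then have "emeasure \<mu> (- ?F) = 0"
    using F by (subst (asm) AE_iff_measurable[of "- ?F"]) (auto simp: space_mu sets_mu)
  moreover have "open (- ?F)"
    using closed_stabilizes by auto
  ultimately have "g \<notin> - ?F"
    using g unfolding measure_support_def by fastforce
  then show ?thesis
    by simp
qed

text \<open>The stabiliser is a closed subgroup containing the support. For inverses, an injective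
  linear map sending a finite-dimensional subspace into itself sends it onto itself.\<close>

lemma closed_subgroup_stabilizes:
  assumes h: "h \<in> closed_subgroup_generated G (measure_support \<mu>)"
  shows "\<rho> h ` almost_surely_slow \<subseteq> almost_surely_slow"
proof -
  let ?L = almost_surely_slow
  let ?H = "{g. \<rho> g ` ?L \<subseteq> ?L}"
  have "subgroup ?H G"
  proof (rule subgroup.intro)
    show "inv g \<in> ?H" if g: "g \<in> ?H" for g
    proof -
      have "inj (\<rho> g)"
        using rep_inv by (metis injI)
      then have "dim (\<rho> g ` ?L) = dim ?L"
        by (intro dim_image_eq linear_rep) (auto intro: inj_on_subset)
      then have "\<rho> g ` ?L = ?L"
        using g subspace_almost_surely_slow
        by (intro subspace_dim_equal linear_subspace_image linear_rep) auto
      then have "\<rho> (inv g) ` ?L = \<rho> (inv g) ` \<rho> g ` ?L"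
        by simp
      also have "\<dots> = ?L"
        by (simp add: image_image rep_inv)
      finally show ?thesis
        by simp
    qed
  qed (auto simp: rep_one rep_mult)
  moreover have "closed ?H"
  proof -
    have "?H = (\<Inter>w\<in>?L. {g. \<rho> g w \<in> ?L})"
      by auto
    then show ?thesis
      using closed_stabilizes by (simp add: closed_INT)
  qed
  moreover have "measure_support \<mu> \<subseteq> ?H"
    using support_stabilizes by blast
  ultimately show ?thesis
    using h unfolding closed_subgroup_generated_def by blast
qed

lemma AE_not_slow:
  assumes W: "\<And>L. subspace L \<Longrightarrow> L \<subseteq> E \<Longrightarrow> L \<noteq> {0} \<Longrightarrow>
      \<forall>h\<in>closed_subgroup_generated G (measure_support \<mu>). \<rho> h ` L \<subseteq> L \<Longrightarrow> L \<inter> W \<noteq> {0}"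
    and v: "v \<in> E" "v \<noteq> 0"
  shows "AE b in S. b \<notin> slow v"
proof -
  have "E \<noteq> {0}"
    using v by auto
  then obtain u where u: "u \<in> E" "u \<noteq> 0"
    and max: "\<And>w. w \<in> E \<Longrightarrow> w \<noteq> 0 \<Longrightarrow> emeasure S (slow w) \<le> emeasure S (slow u)"
    using exists_maximal by blast
  have "emeasure S (slow u) = 0"
  proof (rule ccontr)
    assume "emeasure S (slow u) \<noteq> 0"
    then have "u \<in> almost_surely_slow"
      using zero_one_law[OF u max] u by (simp add: almost_surely_slow_iff)
    then have "almost_surely_slow \<inter> W \<noteq> {0}"
      using u closed_subgroup_stabilizes subspace_almost_surely_slow
      by (intro W) (auto simp: almost_surely_slow_def)
    moreover have "x = 0" if x: "x \<in> almost_surely_slow" "x \<in> W" for x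
    proof -
      have "AE b in S. b \<in> slow x"
        using x by (simp add: almost_surely_slow_def)
      \<comment> \<open>The conclusion does not involve \<open>b\<close>, and on a probability space
        such a statement is true as soon as it holds almost surely.\<close>
      then have "AE b in S. x = 0"
        using slow_subspace
        by eventually_elim (use x in \<open>auto simp: almost_surely_slow_def\<close>)
      then show ?thesis
        by simp
    qed
    moreover have "0 \<in> W"
    proof -
      have "AE b in S. 0 \<in> W"
        using slow_subspace by eventually_elim auto
      then show ?thesis
        by simp
    qed
    ultimately show False
      using subspace_0[OF subspace_almost_surely_slow] by blast
  qed
  then have "emeasure S (slow v) = 0"
    using max[OF v] by simp
  then show ?thesis
    using sets_slow[OF v(1)] by (intro AE_not_in) (auto simp: null_sets_def)
qed

end

end

section \<open>Expansion on Grassmannians\<close>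

theorem proposition2p7:
  fixes G :: "'g::{t2_space,second_countable_topology} monoid"
    and atlas :: "('g set \<times> ('g \<Rightarrow> real^'n::{finite,linorder})) set"
    and U :: "'g set" and \<phi> :: "'g \<Rightarrow> real^'n::{finite,linorder}"
    and norm_g :: "real^'n::{finite,linorder} \<Rightarrow> real"
    and norm_ext :: "nat \<Rightarrow> real^('n set) \<Rightarrow> real"
    and \<mu> :: "'g measure"
    and W :: "nat \<Rightarrow> (real^('n set)) set"
  assumes lie: "lie_group G atlas"
    and chart_at_one: "(U, \<phi>) \<in> atlas" "\<one>\<^bsub>G\<^esub> \<in> U"
    and norm_g: "norm_on UNIV norm_g"
    and norm_ext: "\<And>k. norm_on (ext_power k) (norm_ext k)"
    and mu: "prob_space \<mu>" "sets \<mu> = sets borel"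
    and moment: "finite_first_moment norm_g (Ad G U \<phi>) \<mu>"
    and I: "\<And>k. k \<in> {1..CARD('n) - 1} \<Longrightarrow>
      subspace (W k) \<and> W k \<subset> ext_power k \<and> W k \<noteq> {0} \<and>
      (\<forall>h\<in>closed_subgroup_generated G (measure_support \<mu>). ext_map (Ad G U \<phi> h) ` W k \<subseteq> W k) \<and>
      (AE b in Pi\<^sub>M UNIV (\<lambda>_::nat. \<mu>).
         \<exists>V. oseledets_subexp (ext_power k) (norm_ext k)
               (\<lambda>n. ext_map (Ad G U \<phi> (walk G b n))) V \<and>
             W k \<inter> V = {0})"
    and III: "\<And>k L. \<lbrakk>k \<in> {1..CARD('n) - 1}; subspace L; L \<subseteq> ext_power k; L \<noteq> {0};
        \<forall>h\<in>closed_subgroup_generated G (measure_support \<mu>). ext_map (Ad G U \<phi> h) ` L \<subseteq> L\<rbrakk> \<Longrightarrow> L \<inter> W k \<noteq> {0}"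
  shows "uniformly_expanding_on_Grassmannians G (Ad G U \<phi>) norm_ext \<mu>"
  unfolding uniformly_expanding_on_Grassmannians_def
proof (intro ballI allI impI)
  fix k and vs :: "(real^'n::{finite,linorder}) list"
  assume k: "k \<in> {1..CARD('n) - 1}" and vs: "length vs = k \<and> wedge vs \<noteq> 0"
  interpret lie_group G atlas
    by (rule lie)
  interpret \<mu>: prob_space \<mu>
    by (rule mu(1))
  let ?\<rho> = "\<lambda>g. ext_map (Ad G U \<phi> g)"
  note Ad = linear_Ad[OF chart_at_one] Ad_one[OF chart_at_one] Ad_mult[OF chart_at_one]
    continuous_on_Ad[OF chart_at_one]
  interpret walk: linear_random_walk \<mu> G ?\<rho> "ext_power k" "norm_ext k"
  proof
    show "?\<rho> (g \<otimes>\<^bsub>G\<^esub> h) v = ?\<rho> g (?\<rho> h v)" for g h v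
      using ext_map_compose[OF Ad(1), of g "Ad G U \<phi> h" v] by (simp add: Ad(3)[abs_def])
  qed (auto simp: mu carrier_UNIV linear_add[OF linear_ext_map] linear_cmul[OF linear_ext_map] Ad ext_map_id subspace_ext_power ext_map_in_ext_power
      norm_ext intro!: continuous_on_ext_map)
  have N0: "norm_ext k 0 = 0"
    using norm_ext[of k] subspace_0[OF subspace_ext_power] by (auto simp: norm_on_def)
  note oseledets = I[OF k, THEN conjunct2, THEN conjunct2, THEN conjunct2, THEN conjunct2]
  \<comment> \<open>This puts (I') into the form used for the abstract walk: on the exterior power,
    the Oseledets subspace consists of the slow vectors.\<close>
  have "AE b in walk.S. \<exists>V. subspace V \<and> (\<forall>w\<in>ext_power k. w \<in> V \<longleftrightarrow> b \<in> walk.slow w) \<and> W k \<inter> V = {0}"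
    using oseledets
  proof eventually_elim
    case (elim b)
    then obtain V where V: "oseledets_subexp (ext_power k) (norm_ext k) (\<lambda>n. ?\<rho> (walk G b n)) V"
      and "W k \<inter> V = {0}"
      by (elim exE conjE) (rule that)
    moreover have "w \<in> V \<longleftrightarrow> b \<in> walk.slow w" if "w \<in> ext_power k" for w
      using oseledets_subexp_mem_iff[OF V that] N0 by (simp add: walk.slow_def)
    ultimately show ?case
      using oseledets_subexp_subspace[OF V] by (intro exI[of _ V]) simp
  qed
  then have "AE b in walk.S. wedge vs \<notin> {v. b \<in> walk.slow v}"
    using walk.AE_not_slow[of "W k" "wedge vs"] III[OF k] vs wedge_in_ext_power[of vs] by simp
  \<comment> \<open>Almost surely the wedge product is not slow and so lies outside
    \<open>V\<close>, where the growth rate converges to a positive exponent.\<close>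
  with oseledets show "AE b in Pi\<^sub>M UNIV (\<lambda>_::nat. \<mu>).
      liminf (\<lambda>n. ereal (ln (norm_ext k (?\<rho> (walk G b n) (wedge vs))) / real n)) > 0"
  proof eventually_elim
    case (elim b)
    obtain V where V: "oseledets_subexp (ext_power k) (norm_ext k) (\<lambda>n. ?\<rho> (walk G b n)) V"
      using elim(1) by (elim exE conjE) (rule that)
    have "wedge vs \<in> ext_power k"
      using wedge_in_ext_power[of vs] vs by simp
    moreover from oseledets_subexp_mem_iff[OF V this] have "wedge vs \<notin> V"
      using elim(2) N0 by (simp add: walk.slow_def)
    ultimately show ?case
      by (rule oseledets_subexp_liminf_pos[OF V])
  qed
qed

end
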